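(* For every positive integer $\Delta$, \[ F_{2,\Delta}(n) \sim \left(\frac{n}{\Delta}\right)^{1/2} \quad \text{as } n\rightarrow\infty, \] that is, $\lim_{n\rightarrow\infty} F_{2,\Delta}(n)/(n/\Delta)^{1/2} = 1$.
   Context: For a set $A$ of integers, $2A=\{a+b: a,b\in A\}$. The set $A$ is a $B_2$-set (Sidon set) if, for all $a,b,c,d\in A$, $a+b=c+d$ if and only if $\{a,b\}=\{c,d\}$. A set $X$ of real numbers is $\Delta$-separated if $x'-x\geq\Delta$ for all $x,x'\in X$ with $x<x'$. A $B_{2,\Delta}$-set is a $B_2$-set $A$ whose sumset $2A$ is $\Delta$-separated; equivalently, if $a,b,c,d\in A$ and $\{a,b\}\neq\{c,d\}$, then $|(a+b)-(c+d)|\geq\Delta$. For a positive integer $n$, $F_{2,\Delta}(n)$ denotes the size of the largest $B_{2,\Delta}$-set contained in $\{1,2,\ldots,n\}$. *)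

theory Defs
  imports "HOL-Analysis.Analysis" "HOL-Library.Set_Algebras"
begin

definition B2_set :: "int set \<Rightarrow> bool" where
  "B2_set A \<longleftrightarrow>
     (\<forall>a\<in>A. \<forall>b\<in>A. \<forall>c\<in>A. \<forall>d\<in>A. a + b = c + d \<longleftrightarrow> {a, b} = {c, d})"

definition separated :: "real \<Rightarrow> real set \<Rightarrow> bool" where
  "separated \<Delta> X \<longleftrightarrow> (\<forall>x\<in>X. \<forall>x'\<in>X. x < x' \<longrightarrow> x' - x \<ge> \<Delta>)"

(* A + A is the elementwise sum of sets, i.e. the sumset 2A. *)
definition B2_separated_set :: "real \<Rightarrow> int set \<Rightarrow> bool" where
  "B2_separated_set \<Delta> A \<longleftrightarrow> B2_set A \<and> separated \<Delta> (real_of_int ` (A + A))"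

(* The maximum is over a finite set of cardinalities that contains 0 (take A empty). *)
definition F2 :: "real \<Rightarrow> nat \<Rightarrow> nat" where
  "F2 \<Delta> n = Max {card A | A. A \<subseteq> {1..int n} \<and> B2_separated_set \<Delta> A}"

lemma F2_attained:
  obtains A where "A \<subseteq> {1..int n}" "B2_separated_set \<Delta> A" "card A = F2 \<Delta> n"
proof -
  let ?S = "{card A | A. A \<subseteq> {1..int n} \<and> B2_separated_set \<Delta> A}"
  have "?S \<subseteq> card ` Pow {1..int n}" by auto
  then have "finite ?S" by (rule finite_subset) simp
  moreover have "card ({} :: int set) \<in> ?S"
    by (intro CollectI exI[of _ "{}"])
       (auto simp: B2_separated_set_def B2_set_def separated_def set_plus_def)
  ultimately have "F2 \<Delta> n \<in> ?S" unfolding F2_def using Max_in by blast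
  then show thesis using that by auto
qed

lemma B2_separated_set_iff:
  assumes "\<Delta> > 0"
  shows "B2_separated_set \<Delta> A \<longleftrightarrow>
    (\<forall>a\<in>A. \<forall>b\<in>A. \<forall>c\<in>A. \<forall>d\<in>A. {a, b} \<noteq> {c, d} \<longrightarrow>
       \<bar>real_of_int ((a + b) - (c + d))\<bar> \<ge> \<Delta>)" (is "_ \<longleftrightarrow> ?R")
proof
  assume L: "B2_separated_set \<Delta> A"
  show ?R
  proof (intro ballI impI)
    fix a b c d assume m: "a \<in> A" "b \<in> A" "c \<in> A" "d \<in> A" and ne: "{a, b} \<noteq> {c, d}"
    have B: "B2_set A" and s: "separated \<Delta> (real_of_int ` (A + A))"
      using L by (simp_all add: B2_separated_set_def)
    have "a + b \<noteq> c + d"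
      using B[unfolded B2_set_def, rule_format, OF m] ne by metis
    then have neq: "real_of_int (a + b) \<noteq> real_of_int (c + d)"
      by (simp only: of_int_eq_iff not_False_eq_True)
    have ab: "real_of_int (a + b) \<in> real_of_int ` (A + A)"
      by (intro imageI set_plus_intro m)
    have cd: "real_of_int (c + d) \<in> real_of_int ` (A + A)"
      by (intro imageI set_plus_intro m)
    show "\<bar>real_of_int ((a + b) - (c + d))\<bar> \<ge> \<Delta>"
      using s[unfolded separated_def, rule_format, OF ab cd]
        s[unfolded separated_def, rule_format, OF cd ab] neq
      unfolding of_int_diff by linarith
  qed
next
  assume R: ?R
  have "B2_set A"
    unfolding B2_set_def
  proof (intro ballI iffI)
    fix a b c d assume m: "a \<in> A" "b \<in> A" "c \<in> A" "d \<in> A" and "a + b = c + d"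
    then show "{a, b} = {c, d}" using R[rule_format, OF m] assms by auto
  qed (auto simp: doubleton_eq_iff)
  moreover have "separated \<Delta> (real_of_int ` (A + A))"
    unfolding separated_def
  proof (intro ballI impI)
    fix x y assume xy: "x \<in> real_of_int ` (A + A)" "y \<in> real_of_int ` (A + A)" "x < y"
    then obtain a b c d where
      m: "a \<in> A" "b \<in> A" "c \<in> A" "d \<in> A" "x = real_of_int (c + d)" "y = real_of_int (a + b)"
      by (auto elim!: set_plus_elim)
    then have "{a, b} \<noteq> {c, d}" using xy(3) by (auto simp: doubleton_eq_iff)
    then have "\<bar>real_of_int ((a + b) - (c + d))\<bar> \<ge> \<Delta>" using R[rule_format, OF m(1-4)] by simp
    then show "y - x \<ge> \<Delta>" using m xy(3) by simp
  qed
  ultimately show "B2_separated_set \<Delta> A" unfolding B2_separated_set_def by blast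
qed

end

theory Submission
  imports Defs "HOL-Complex_Analysis.Complex_Analysis" "HOL-Number_Theory.Number_Theory"
    "HOL-Real_Asymp.Real_Asymp"
begin

text \<open>
  Lower bound. Dilating Ruzsa's Sidon set by \<open>\<Delta>\<close> gives, for a prime \<open>p\<close> with \<open>\<Delta> p (p - 1) \<le> n\<close>, a set with
  \<open>p - 1\<close> elements (\<open>F2_ge_prime\<close>). For this to be asymptotic to the square root of \<open>n / \<Delta>\<close>, there must be primes
  between \<open>(1 - \<epsilon>) x\<close> and \<open>x\<close> for all large \<open>x\<close> (\<open>eventually_prime_ln_near\<close>). This consequence of the prime number
  theorem carries most of the proof.

  Upper bound. In a window of length \<open>u\<close>, the positive differences of elements of the set are distinct and \<open>\<Delta>\<close>-separated, so
  that averaging over all windows gives, by the method of Erdos and Turan,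
  \<open>|A|\<^sup>2 \<le> (n + u) (|A| / u + 1 / \<Delta>)\<close> (\<open>F2_le\<close>). With \<open>u\<close> a small multiple of \<open>n\<close>, the first summand in
  the second factor is negligible.

  Primes in short intervals. The function \<open>(s - 1) \<zeta>(s)\<close> is holomorphic for \<open>Re s > 0\<close> and has no zeros with
  \<open>Re s \<ge> 1\<close> (\<open>reg_zeta_nonzero\<close>). Hence the Dirichlet series with coefficients \<open>\<Lambda>(n) - 1\<close> extends holomorphically across
  \<open>Re s = 1\<close> (\<open>mangoldt_minus_zeta_extension\<close>). A Fejer kernel on the logarithmic scale is the Fourier transform
  of a compactly supported function, so weighting this series with a kernel centred at \<open>z\<close> produces an
  oscillatory integral over a bounded segment, which tends to 0 as \<open>z\<close> grows (\<open>mangoldt_fejer_diff\<close>).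
  Therefore the weights \<open>\<Lambda>(n)\<close> and 1 have the same mass under a fixed kernel, up to a small error. A narrow kernel
  sees a fixed positive mass, nearly all of it close to its centre; so a gap in the primes around
  the centre is impossible. Working at the abscissa \<open>1 + 1 / y\<close>, with bounds uniform in the abscissa,
  avoids limits of the series on the line \<open>Re s = 1\<close>.
\<close>

section \<open>Dirichlet series with logarithmic coefficients\<close>

lemma norm_nat_powr: "norm (of_nat n powr (-s) :: complex) = real n powr (- Re s)"
  by (subst norm_powr_real_powr) auto

lemma summable_log_powr:
  assumes "c > 1"
  shows "summable (\<lambda>n. (1 + ln (real n)) * real n powr (-c))"
proof (rule summable_comparison_test)
  let ?e = "(c - 1) / 2"
  let ?K = "1 + 1 / ?e"
  show "summable (\<lambda>n. ?K * real n powr (-(1 + ?e)))"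
    using assms by (intro summable_mult) (subst summable_real_powr_iff, simp)
  have "norm ((1 + ln (real n)) * real n powr (-c)) \<le> ?K * real n powr (-(1 + ?e))" if "n \<ge> 1" for n
  proof -
    have a: "ln (real n) \<le> real n powr ?e / ?e" using that assms by (intro ln_powr_bound) auto
    have b: "1 \<le> real n powr ?e" using that assms by (intro ge_one_powr_ge_zero) auto
    have c: "1 + ln (real n) \<le> ?K * real n powr ?e" using a b by (simp add: algebra_simps)
    have "norm ((1 + ln (real n)) * real n powr (-c)) = (1 + ln (real n)) * real n powr (-c)"
      using that by simp
    also have "\<dots> \<le> ?K * real n powr ?e * real n powr (-c)"
      by (intro mult_right_mono c) simp
    also have "\<dots> = ?K * real n powr (-(1 + ?e))"
      by (simp add: mult.assoc powr_add[symmetric]) (simp add: field_simps)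
    finally show ?thesis .
  qed
  then show "\<exists>N. \<forall>n\<ge>N. norm ((1 + ln (real n)) * real n powr (-c)) \<le> ?K * real n powr (-(1 + ?e))"
    by blast
qed

text \<open>
  Every Dirichlet series below has coefficients of modulus at most \<open>1 + ln n\<close>. The term \<open>n = 0\<close> of a series
  over all naturals vanishes, since \<open>0 powr s = 0\<close>.
\<close>

lemma norm_dirichlet_term_le:
  assumes "\<And>n. n > 0 \<Longrightarrow> norm (a n) \<le> 1 + ln (real n)" "Re s \<ge> c"
  shows "norm (a n * of_nat n powr (-s) :: complex) \<le> (1 + ln (real n)) * real n powr (-c)"
proof (cases "n > 0")
  case True
  have "norm (a n * of_nat n powr (-s)) = norm (a n) * real n powr (- Re s)"
    by (simp add: norm_mult norm_nat_powr)
  also have "\<dots> \<le> (1 + ln (real n)) * real n powr (-c)"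
    using assms True by (intro mult_mono powr_mono) auto
  finally show ?thesis .
qed auto

lemma dirichlet_abs_summable:
  assumes "\<And>n. n > 0 \<Longrightarrow> norm (a n) \<le> 1 + ln (real n)" "Re s > 1"
  shows "summable (\<lambda>n. norm (a n * of_nat n powr (-s) :: complex))"
  by (rule summable_comparison_test'[OF summable_log_powr[OF assms(2)], where N = 0])
     (use norm_dirichlet_term_le[of a "Re s" s, OF assms(1)] in auto)

lemma dirichlet_summable:
  assumes "\<And>n. n > 0 \<Longrightarrow> norm (a n) \<le> 1 + ln (real n)" "Re s > 1"
  shows "summable (\<lambda>n. a n * of_nat n powr (-s) :: complex)"
  by (rule summable_norm_cancel[OF dirichlet_abs_summable[OF assms]])

text \<open>
  The Riemann zeta function, as its Dirichlet series; meaningful only for \<open>Re s > 1\<close>.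
\<close>

definition zeta_series :: "complex \<Rightarrow> complex" where
  "zeta_series s = (\<Sum>n. of_nat n powr (-s))"

text \<open>
  The Dirichlet series of the von Mangoldt function, which is \<open>- \<zeta>' / \<zeta>\<close> for \<open>Re s > 1\<close>.
\<close>

definition mangoldt_series :: "complex \<Rightarrow> complex" where
  "mangoldt_series s = (\<Sum>n. mangoldt n * of_nat n powr (-s))"

lemma mangoldt_bound: "n > 0 \<Longrightarrow> norm (mangoldt n :: complex) \<le> 1 + ln (real n)"
  using mangoldt_le[of n] by simp

lemma one_bound: "n > 0 \<Longrightarrow> norm (1 :: complex) \<le> 1 + ln (real n)"
  by simp

lemma ln_bound: "n > 0 \<Longrightarrow> norm (of_real (ln (real n)) :: complex) \<le> 1 + ln (real n)"
  by simp

lemma zeta_series_deriv: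
  assumes "Re s > 1"
  shows "(zeta_series has_field_derivative - (\<Sum>n. of_real (ln (real n)) * of_nat n powr (-s))) (at s)"
proof -
  define c where "c = (1 + Re s) / 2"
  have c: "c > 1" "c < Re s" using assms by (auto simp: c_def)
  let ?S = "{z. Re z > c}"
  have op: "open ?S" by (rule open_halfspace_Re_gt)
  have "((\<lambda>z. \<Sum>n. of_nat n powr (-z)) has_field_derivative
      (\<Sum>n. - (of_real (ln (real n)) * of_nat n powr (-s)))) (at s)"
  proof (rule has_field_derivative_series'(2))
    show "convex ?S" by (rule convex_halfspace_Re_gt)
    show "s \<in> ?S" "s \<in> interior ?S" using c op by (auto simp: interior_open)
    show "summable (\<lambda>n. of_nat n powr (-s) :: complex)"
      using dirichlet_summable[of "\<lambda>_. 1" s, OF one_bound assms] by simp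
    show "((\<lambda>z. of_nat n powr (-z)) has_field_derivative - (of_real (ln (real n)) * of_nat n powr (-z)))
            (at z within ?S)" for n z
    proof (cases "n = 0")
      case False
      have ln: "Ln (of_nat n) = of_real (ln (real n))"
        using False Ln_of_real[of "real n"] by simp
      have "((\<lambda>z. of_nat n powr (-z)) has_field_derivative (Ln (of_nat n) * of_nat n powr (-z)) * (-1)) (at z within ?S)"
        using False
        by (intro DERIV_chain2[where f = "\<lambda>w. of_nat n powr w" and g = uminus] has_field_derivative_powr_right)
           (auto intro!: derivative_eq_intros)
      then show ?thesis by (simp add: ln)
    qed auto
    show "uniformly_convergent_on ?S (\<lambda>n x. \<Sum>i<n. - (of_real (ln (real i)) * of_nat i powr (-x) :: complex))"
    proof (rule Weierstrass_m_test'[OF _ summable_log_powr[OF c(1)]])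
      fix n x assume "x \<in> ?S"
      then show "norm (- (of_real (ln (real n)) * of_nat n powr (-x) :: complex)) \<le> (1 + ln (real n)) * real n powr (-c)"
        using norm_dirichlet_term_le[of "\<lambda>n. of_real (ln (real n))" c x n, OF ln_bound] by simp
    qed
  qed
  then show ?thesis
    using suminf_minus[OF dirichlet_summable[of "\<lambda>n. of_real (ln (real n))" s, OF ln_bound assms]]
    by (simp add: zeta_series_def[abs_def])
qed

text \<open>
  The Dirichlet series identity behind \<open>\<Lambda> * 1 = ln\<close>: the absolutely convergent double sum over
  \<open>(d, k)\<close> is rearranged according to the product \<open>n = d k\<close>.
\<close>

lemma mangoldt_times_zeta:
  assumes "Re s > 1"
  shows "mangoldt_series s * zeta_series s = (\<Sum>n. of_real (ln (real n)) * of_nat n powr (-s))"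
proof -
  let ?f = "\<lambda>n. mangoldt n * of_nat n powr (-s) :: complex"
  let ?g = "\<lambda>n. of_nat n powr (-s) :: complex"
  let ?P = "{1..} :: nat set"
  have nf: "summable (\<lambda>n. norm (?f n))" by (rule dirichlet_abs_summable[OF mangoldt_bound assms])
  have ng: "summable (\<lambda>n. norm (?g n))"
    using dirichlet_abs_summable[of "\<lambda>_. 1" s, OF one_bound assms] by simp
  have hf: "(?f has_sum mangoldt_series s) UNIV" unfolding mangoldt_series_def
    by (intro norm_summable_imp_has_sum nf summable_sums summable_norm_cancel[OF nf])
  have hg: "(?g has_sum zeta_series s) UNIV" unfolding zeta_series_def
    by (intro norm_summable_imp_has_sum ng summable_sums summable_norm_cancel[OF ng])
  have hf': "(?f has_sum mangoldt_series s) ?P"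
    using hf by (subst has_sum_cong_neutral[of UNIV]) (auto simp: not_less_eq_eq)
  have hg': "(?g has_sum zeta_series s) ?P"
    using hg by (subst has_sum_cong_neutral[of UNIV]) (auto simp: not_less_eq_eq)
  have sf: "(\<lambda>n. norm (?f n)) summable_on ?P"
    using norm_summable_imp_summable_on[of "\<lambda>n. norm (?f n)"] nf
    by (auto intro: summable_on_subset_banach)
  have sg: "(\<lambda>n. norm (?g n)) summable_on ?P"
    using norm_summable_imp_summable_on[of "\<lambda>n. norm (?g n)"] ng
    by (auto intro: summable_on_subset_banach)
  have "(\<lambda>x. norm (case x of (d,k) \<Rightarrow> ?f d * ?g k)) summable_on ?P \<times> ?P"
    unfolding Infinite_Sum.abs_summable_on_Sigma_iff
  proof (intro conjI ballI)
    show "(\<lambda>y. norm (case (x, y) of (d, k) \<Rightarrow> ?f d * ?g k)) summable_on ?P" for x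
      unfolding prod.case norm_mult by (intro summable_on_cmult_right sg[unfolded norm_mult])
    show "(\<lambda>x. norm (\<Sum>\<^sub>\<infinity>y\<in>?P. norm (case (x, y) of (d, k) \<Rightarrow> ?f d * ?g k))) summable_on ?P"
      unfolding prod.case norm_mult[of "_ * _"] infsum_cmult_right'
      using summable_on_cmult_left[OF sf, of "norm (\<Sum>\<^sub>\<infinity>y\<in>?P. norm (?g y))"]
      by (simp add: norm_mult abs_mult)
  qed
  then have sm: "(\<lambda>(d,k). ?f d * ?g k) summable_on ?P \<times> ?P" by (rule abs_summable_summable)
  have tot: "((\<lambda>(d,k). ?f d * ?g k) has_sum (mangoldt_series s * zeta_series s)) (?P \<times> ?P)"
    by (rule has_sum_SigmaI[OF _ _ sm, of "\<lambda>d. ?f d * zeta_series s"])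
       (auto intro!: has_sum_cmult_right has_sum_cmult_left hg'[simplified] hf'[simplified])
  have "((\<lambda>(n,d). mangoldt d * of_nat n powr (-s)) has_sum (mangoldt_series s * zeta_series s))
          (SIGMA n:?P. {d. d dvd n})"
    using tot
  proof (subst has_sum_reindex_bij_witness[where j = "\<lambda>(n,d). (d, n div d)" and i = "\<lambda>(d,k). (d * k, d)"
        and T = "?P \<times> ?P" and h = "\<lambda>(d,k). ?f d * ?g k" and s' = "mangoldt_series s * zeta_series s"])
    fix a :: "nat \<times> nat" assume "a \<in> (SIGMA n:?P. {d. d dvd n})"
    then obtain d k where a: "a = (d * k, d)" "d > 0" "k > 0"
      by (auto elim!: dvdE)
    then show "(case case a of (n, d) \<Rightarrow> (d, n div d) of (d, k) \<Rightarrow> (d * k, d)) = a"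
      and "(case a of (n, d) \<Rightarrow> (d, n div d)) \<in> ?P \<times> ?P" by auto
    have "of_nat (d * k) powr (-s) = of_nat d powr (-s) * (of_nat k powr (-s) :: complex)"
      by (simp add: powr_times_real)
    then show "(case case a of (n, d) \<Rightarrow> (d, n div d) of (d, k) \<Rightarrow> ?f d * ?g k) =
         (case a of (n, d) \<Rightarrow> mangoldt d * of_nat n powr (-s))" using a by simp
  qed auto
  then have "((\<lambda>n. \<Sum>d | d dvd n. mangoldt d * of_nat n powr (-s)) has_sum (mangoldt_series s * zeta_series s)) ?P"
    by (rule has_sum_SigmaD) (auto intro!: has_sum_finite)
  also have "?this \<longleftrightarrow> ((\<lambda>n. of_real (ln (real n)) * of_nat n powr (-s)) has_sum (mangoldt_series s * zeta_series s)) ?P"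
    by (intro has_sum_cong) (auto simp: sum_distrib_right[symmetric] mangoldt_sum)
  also have "\<dots> \<longleftrightarrow> ((\<lambda>n. of_real (ln (real n)) * of_nat n powr (-s)) has_sum (mangoldt_series s * zeta_series s)) UNIV"
    by (intro has_sum_cong_neutral) (auto simp: not_less_eq_eq)
  finally show ?thesis using has_sum_imp_sums sums_unique by blast
qed

section \<open>Continuation of the zeta function\<close>

text \<open>
  The summands of a series for \<open>(s - 1) \<zeta>(s)\<close>. For \<open>n > 0\<close> a summand is
  \<open>s - 1\<close> times the difference between \<open>n powr (-s)\<close> and the integral of \<open>x powr (-s)\<close> over
  \<open>[n, n + 1]\<close>, multiplied out so that nothing is singular at \<open>s = 1\<close>. For \<open>n = 0\<close> it is the
  constant 1, because \<open>0 powr s = 0\<close>.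
\<close>

definition reg_zeta_term :: "nat \<Rightarrow> complex \<Rightarrow> complex" where
  "reg_zeta_term n s = (s - 1) * of_nat n powr (-s) + of_nat (Suc n) powr (1 - s) - of_nat n powr (1 - s)"

text \<open>
  The function \<open>(s - 1) \<zeta>(s)\<close>, continued holomorphically to \<open>Re s > 0\<close>.
\<close>

definition reg_zeta :: "complex \<Rightarrow> complex" where
  "reg_zeta s = (\<Sum>n. reg_zeta_term n s)"

lemma norm_reg_zeta_term_le:
  assumes n: "n > 0" and s: "Re s > 0"
  shows "norm (reg_zeta_term n s) \<le> norm (s - 1) * (norm s * real n powr (- Re s - 1))"
proof -
  let ?S = "closed_segment (of_nat n) (of_nat (Suc n)) :: complex set"
  have seg: "z \<in> \<real> \<and> Re z \<ge> real n \<and> z \<notin> \<real>\<^sub>\<le>\<^sub>0 \<and> norm (z - of_nat n) \<le> 1" if "z \<in> ?S" for z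
  proof -
    from that obtain u where u: "0 \<le> u" "u \<le> 1" "z = (1 - u) *\<^sub>R of_nat n + u *\<^sub>R of_nat (Suc n)"
      by (auto simp: in_segment)
    have z: "z = of_real (real n + u)" using u(3) by (simp add: scaleR_conv_of_real algebra_simps)
    have d: "z - of_nat n = of_real u" by (simp add: z)
    have "norm (z - of_nat n) = u" unfolding d norm_of_real using u(1) by simp
    then show ?thesis using n u(1,2) by (auto simp: z complex_nonpos_Reals_iff)
  qed
  \<comment> \<open>The mean value inequality is used twice, for z powr (-s) and then for the function q below.\<close>
  have B1: "norm (z powr (-s) - of_nat n powr (-s)) \<le> norm s * real n powr (- Re s - 1)" if z: "z \<in> ?S" for z
  proof -
    have "norm (z powr (-s) - of_nat n powr (-s)) \<le> (norm s * real n powr (- Re s - 1)) * norm (z - of_nat n)"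
    proof (rule field_differentiable_bound[where S = "?S" and f' = "\<lambda>z. -s * z powr (-s - 1)"])
      fix w assume w: "w \<in> ?S"
      show "((\<lambda>z. z powr (-s)) has_field_derivative -s * w powr (-s - 1)) (at w within ?S)"
        using seg[OF w] by (auto intro!: derivative_eq_intros)
      have "norm (-s * w powr (-s - 1)) = norm s * Re w powr (- Re s - 1)"
        using seg[OF w] by (simp add: norm_mult norm_powr_real_powr)
      also have "\<dots> \<le> norm s * real n powr (- Re s - 1)"
        using seg[OF w] n s by (intro mult_left_mono powr_mono2') auto
      finally show "norm (-s * w powr (-s - 1)) \<le> norm s * real n powr (- Re s - 1)" .
    qed (use z in auto)
    also have "\<dots> \<le> (norm s * real n powr (- Re s - 1)) * 1"
      using seg[OF z] by (intro mult_left_mono) auto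
    finally show ?thesis by simp
  qed
  let ?q = "\<lambda>z. (s - 1) * z * of_nat n powr (-s) + z powr (1 - s)"
  have "norm (?q (of_nat (Suc n)) - ?q (of_nat n))
          \<le> (norm (s - 1) * (norm s * real n powr (- Re s - 1))) * norm (of_nat (Suc n) - of_nat n :: complex)"
  proof (rule field_differentiable_bound[where S = "?S" and f' = "\<lambda>z. (s - 1) * (of_nat n powr (-s) - z powr (-s))"])
    fix w assume w: "w \<in> ?S"
    show "(?q has_field_derivative (s - 1) * (of_nat n powr (-s) - w powr (-s))) (at w within ?S)"
      using seg[OF w] by (auto intro!: derivative_eq_intros simp: algebra_simps)
    show "norm ((s - 1) * (of_nat n powr (-s) - w powr (-s))) \<le> norm (s - 1) * (norm s * real n powr (- Re s - 1))"
      unfolding norm_mult by (intro mult_left_mono) (use B1[OF w] in \<open>auto simp: norm_minus_commute\<close>)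
  qed auto
  also have "norm (of_nat (Suc n) - of_nat n :: complex) = 1" by simp
  also have "?q (of_nat (Suc n)) - ?q (of_nat n) = reg_zeta_term n s"
    by (simp add: reg_zeta_term_def algebra_simps)
  finally show ?thesis by simp
qed

lemma reg_zeta_holomorphic: "reg_zeta holomorphic_on {s. Re s > 0}"
proof (rule holomorphic_uniform_sequence)
  show "open {s. Re s > 0}" by (rule open_halfspace_Re_gt)
  show "(\<lambda>s. \<Sum>i<n. reg_zeta_term i s) holomorphic_on {s. Re s > 0}" for n
  proof (rule holomorphic_on_sum)
    show "reg_zeta_term i holomorphic_on {s. Re s > 0}" for i
      unfolding reg_zeta_term_def[abs_def]
      by (cases "i = 0") (auto intro!: holomorphic_intros simp del: of_nat_Suc)
  qed
  fix x :: complex assume x: "x \<in> {s. Re s > 0}"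
  define d where "d = Re x / 2"
  define M where "M = norm x + d + 1"
  have d: "d > 0" using x by (simp add: d_def)
  have *: "Re s \<ge> d \<and> norm s \<le> M \<and> norm (s - 1) \<le> M" if "s \<in> cball x d" for s
  proof -
    have ns: "norm (x - s) \<le> d" using that by (simp add: dist_norm)
    have "Re x - Re s \<le> d" using complex_Re_le_cmod[of "x - s"] ns by simp
    moreover have "norm s \<le> norm x + d" using norm_triangle_ineq2[of s x] ns by (simp add: norm_minus_commute)
    moreover have "norm (s - 1) \<le> norm s + 1" using norm_triangle_ineq4[of s 1] by simp
    ultimately show ?thesis by (auto simp: d_def M_def)
  qed
  have "uniform_limit (cball x d) (\<lambda>n s. \<Sum>i<n. reg_zeta_term i s) (\<lambda>s. \<Sum>i. reg_zeta_term i s) sequentially"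
  proof (rule Weierstrass_m_test_ev)
    show "summable (\<lambda>n. M * (M * real n powr (-d - 1)))"
      using d by (intro summable_mult) (subst summable_real_powr_iff, simp)
    show "\<forall>\<^sub>F n in sequentially. \<forall>s\<in>cball x d. norm (reg_zeta_term n s) \<le> M * (M * real n powr (-d - 1))"
      using eventually_gt_at_top[of 0]
    proof eventually_elim
      case (elim n)
      show ?case
      proof
        fix s assume s: "s \<in> cball x d"
        have "norm (reg_zeta_term n s) \<le> norm (s - 1) * (norm s * real n powr (- Re s - 1))"
          using norm_reg_zeta_term_le[OF elim, of s] *[OF s] d by auto
        also have "\<dots> \<le> M * (M * real n powr (-d - 1))"
          using *[OF s] elim d order_trans[OF norm_ge_zero, of s M] by (intro mult_mono powr_mono) auto
        finally show "norm (reg_zeta_term n s) \<le> M * (M * real n powr (-d - 1))" .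
      qed
    qed
  qed
  then show "\<exists>d>0. cball x d \<subseteq> {s. Re s > 0} \<and>
      uniform_limit (cball x d) (\<lambda>n s. \<Sum>i<n. reg_zeta_term i s) reg_zeta sequentially"
    using d * by (intro exI[of _ d]) (auto simp: reg_zeta_def[abs_def] intro: less_le_trans[OF d])
qed

lemma reg_zeta_1: "reg_zeta 1 = 1"
proof -
  have "reg_zeta 1 = (\<Sum>n\<in>{0}. reg_zeta_term n 1)"
    unfolding reg_zeta_def by (rule suminf_finite) (auto simp: reg_zeta_term_def simp del: of_nat_Suc)
  then show ?thesis by (simp add: reg_zeta_term_def)
qed

lemma reg_zeta_eq:
  assumes "Re s > 1"
  shows "reg_zeta s = (s - 1) * zeta_series s"
proof -
  \<comment> \<open>The differences of powers telescope to 0: both ends vanish, the lower one by the default value at 0.\<close>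
  have "(\<lambda>n. of_nat n powr (1 - s) :: complex) \<longlonglongrightarrow> 0"
  proof (rule tendsto_norm_zero_cancel)
    have "norm (of_nat n powr (1 - s) :: complex) = real n powr (1 - Re s)" for n
      using norm_nat_powr[of n "s - 1"] by simp
    moreover have "(\<lambda>n. real n powr (1 - Re s)) \<longlonglongrightarrow> 0"
      using assms by (intro tendsto_neg_powr filterlim_real_sequentially) auto
    ultimately show "(\<lambda>n. norm (of_nat n powr (1 - s) :: complex)) \<longlonglongrightarrow> 0" by simp
  qed
  from telescope_sums[OF this]
  have t: "(\<lambda>n. of_nat (Suc n) powr (1 - s) - of_nat n powr (1 - s) :: complex) sums 0" by simp
  have "(\<lambda>n. of_nat n powr (-s)) sums zeta_series s" unfolding zeta_series_def
    using dirichlet_summable[of "\<lambda>_. 1" s, OF one_bound assms] by (intro summable_sums) simp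
  from sums_add[OF sums_mult[OF this, of "s - 1"] t]
  have "(\<lambda>n. reg_zeta_term n s) sums ((s - 1) * zeta_series s)"
    by (simp add: reg_zeta_term_def algebra_simps del: of_nat_Suc)
  then show ?thesis by (simp add: reg_zeta_def sums_iff)
qed

lemma mangoldt_series_eq:
  assumes "Re s > 1" "reg_zeta s \<noteq> 0"
  shows "mangoldt_series s = 1 / (s - 1) - deriv reg_zeta s / reg_zeta s"
proof -
  have z: "zeta_series s \<noteq> 0" and s1: "s \<noteq> 1" using assms reg_zeta_eq[OF assms(1)] by auto
  let ?d = "- (mangoldt_series s * zeta_series s)"
  have dz: "(zeta_series has_field_derivative ?d) (at s)"
    using zeta_series_deriv[OF assms(1)] mangoldt_times_zeta[OF assms(1)] by simp
  have "((\<lambda>s. (s - 1) * zeta_series s) has_field_derivative (zeta_series s + (s - 1) * ?d)) (at s)"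
    by (auto intro!: derivative_eq_intros dz)
  then have "(reg_zeta has_field_derivative (zeta_series s + (s - 1) * ?d)) (at s)"
    by (rule has_field_derivative_transform_within_open[OF _ open_halfspace_Re_gt[of 1]])
       (use assms reg_zeta_eq in auto)
  then have d: "deriv reg_zeta s = zeta_series s + (s - 1) * ?d" by (rule DERIV_imp_deriv)
  have "deriv reg_zeta s / reg_zeta s = 1 / (s - 1) - mangoldt_series s"
    unfolding d reg_zeta_eq[OF assms(1)] using z s1 by (simp add: field_simps)
  then show ?thesis by simp
qed

section \<open>Nonvanishing of the zeta function on the line of abscissa one\<close>

text \<open>
  The residue of a logarithmic derivative is the order of the zero.
\<close>

lemma log_deriv_residue:
  assumes hol: "f holomorphic_on S" and S: "open S" "connected S" "s0 \<in> S"
    and nz: "z1 \<in> S" "f z1 \<noteq> 0"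
  obtains m :: nat where "m = 0 \<longleftrightarrow> f s0 \<noteq> 0"
    "((\<lambda>z. (z - s0) * (deriv f z / f z)) \<longlongrightarrow> of_nat m) (at s0)"
    "\<forall>\<^sub>F z in at s0. f z \<noteq> 0"
proof (cases "f s0 = 0")
  case False
  have c: "isCont f s0" "isCont (deriv f) s0"
    using hol holomorphic_deriv[OF hol S(1)] S
    by (auto simp: continuous_on_eq_continuous_at dest!: holomorphic_on_imp_continuous_on)
  have "((\<lambda>z. (z - s0) * (deriv f z / f z)) \<longlongrightarrow> (s0 - s0) * (deriv f s0 / f s0)) (at s0)"
    using c False by (intro tendsto_intros) (auto simp: isCont_def)
  moreover have "\<forall>\<^sub>F z in at s0. f z \<noteq> 0"
    using c(1) False by (intro tendsto_imp_eventually_ne) (auto simp: isCont_def)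
  ultimately show ?thesis using that[of 0] False by simp
next
  case True
  have "\<not> f constant_on S" using True nz S unfolding constant_on_def by metis
  from holomorphic_factor_zero_nonconstant[OF hol S(1,2,3) True this]
  obtain g r n where g: "0 < n" "0 < r" "ball s0 r \<subseteq> S" "g holomorphic_on ball s0 r"
    "\<And>w. w \<in> ball s0 r \<Longrightarrow> f w = (w - s0)^n * g w" "\<And>w. w \<in> ball s0 r \<Longrightarrow> g w \<noteq> 0" by metis
  have c: "isCont g s0" "isCont (deriv g) s0"
    using g holomorphic_deriv[OF g(4)]
    by (auto simp: continuous_on_eq_continuous_at dest!: holomorphic_on_imp_continuous_on)
  have ev: "\<forall>\<^sub>F z in at s0. z \<in> ball s0 r \<and> z \<noteq> s0"
    using g(2) by (auto simp: eventually_at dist_commute)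
  have "((\<lambda>z. of_nat n + (z - s0) * (deriv g z / g z)) \<longlongrightarrow> of_nat n + (s0 - s0) * (deriv g s0 / g s0)) (at s0)"
    using c g by (intro tendsto_intros) (auto simp: isCont_def)
  moreover have "\<forall>\<^sub>F z in at s0. (z - s0) * (deriv f z / f z) = of_nat n + (z - s0) * (deriv g z / g z)"
    using ev
  proof eventually_elim
    case (elim z)
    have dg: "(g has_field_derivative deriv g z) (at z)"
      using g(4) elim by (intro holomorphic_derivI) auto
    have "((\<lambda>w. (w - s0)^n * g w) has_field_derivative
            (of_nat n * (z - s0)^(n - 1) * g z + (z - s0)^n * deriv g z)) (at z)"
      by (auto intro!: derivative_eq_intros dg)
    then have "(f has_field_derivative (of_nat n * (z - s0)^(n - 1) * g z + (z - s0)^n * deriv g z)) (at z)"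
      by (rule has_field_derivative_transform_within_open[where S = "ball s0 r"]) (use elim g in auto)
    then have d: "deriv f z = of_nat n * (z - s0)^(n - 1) * g z + (z - s0)^n * deriv g z" by (rule DERIV_imp_deriv)
    obtain k where k: "n = Suc k" using g(1) gr0_conv_Suc by auto
    define w where "w = z - s0"
    have w: "w \<noteq> 0" and gz: "g z \<noteq> 0" and fz: "f z = w ^ n * g z"
      using elim g(5,6) by (auto simp: w_def)
    show ?case unfolding d fz w_def[symmetric] unfolding k using w gz by (simp add: field_simps)
  qed
  ultimately have "((\<lambda>z. (z - s0) * (deriv f z / f z)) \<longlongrightarrow> of_nat n) (at s0)"
    by (simp add: tendsto_cong)
  moreover have "\<forall>\<^sub>F z in at s0. f z \<noteq> 0"
    using ev by eventually_elim (use g in auto)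
  ultimately show ?thesis using that[of n] g(1) True by simp
qed

text \<open>
  Approaching a point of \<open>Re s \<ge> 1\<close> horizontally from the right, the growth of the Mangoldt series
  shows the order \<open>m\<close> of the zero of \<open>(s - 1) \<zeta>(s)\<close> there; the pole of \<open>\<zeta>\<close> contributes the 1.
\<close>

lemma mangoldt_series_residue:
  assumes s0: "Re s0 \<ge> 1"
  obtains m :: nat where "m = 0 \<longleftrightarrow> reg_zeta s0 \<noteq> 0"
    "((\<lambda>e. of_real e * mangoldt_series (s0 + of_real e)) \<longlongrightarrow> (if s0 = 1 then 1 else 0) - of_nat m) (at_right 0)"
proof -
  let ?S = "{s. Re s > 0}"
  have "connected ?S" by (intro convex_connected convex_halfspace_Re_gt)
  moreover have "s0 \<in> ?S" "1 \<in> ?S" "reg_zeta 1 \<noteq> 0" using s0 reg_zeta_1 by auto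
  ultimately obtain m :: nat where m: "m = 0 \<longleftrightarrow> reg_zeta s0 \<noteq> 0"
    and lim: "((\<lambda>z. (z - s0) * (deriv reg_zeta z / reg_zeta z)) \<longlongrightarrow> of_nat m) (at s0)"
    and ev: "\<forall>\<^sub>F z in at s0. reg_zeta z \<noteq> 0"
    by (rule log_deriv_residue[OF reg_zeta_holomorphic open_halfspace_Re_gt])
  have fl: "filterlim (\<lambda>e. s0 + of_real e) (at s0) (at_right 0)"
    unfolding filterlim_at
  proof
    show "((\<lambda>e. s0 + of_real e) \<longlongrightarrow> s0) (at_right 0)" by (auto intro!: tendsto_eq_intros)
    show "\<forall>\<^sub>F e in at_right 0. s0 + of_real e \<in> UNIV \<and> s0 + of_real e \<noteq> s0"
      using eventually_at_right_less[of "0::real"] by eventually_elim auto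
  qed
  have L1: "((\<lambda>e. of_real e * (deriv reg_zeta (s0 + of_real e) / reg_zeta (s0 + of_real e))) \<longlongrightarrow> of_nat m) (at_right 0)"
    using filterlim_compose[OF lim fl] by simp
  have L2: "((\<lambda>e. of_real e / (s0 + of_real e - 1)) \<longlongrightarrow> (if s0 = 1 then 1 else 0)) (at_right 0)"
  proof (cases "s0 = 1")
    case True
    have "\<forall>\<^sub>F e in at_right (0::real). of_real e / (s0 + of_real e - 1) = (1 :: complex)"
      using eventually_at_right_less[of "0::real"] by eventually_elim (simp add: True)
    then show ?thesis by (simp add: True tendsto_eventually)
  next
    case False
    have "((\<lambda>e. of_real e / (s0 + of_real e - 1)) \<longlongrightarrow> of_real 0 / (s0 + of_real 0 - 1)) (at_right 0)"
      using False by (intro tendsto_intros) auto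
    then show ?thesis using False by simp
  qed
  have "\<forall>\<^sub>F e in at_right 0. of_real e / (s0 + of_real e - 1) -
          of_real e * (deriv reg_zeta (s0 + of_real e) / reg_zeta (s0 + of_real e)) = of_real e * mangoldt_series (s0 + of_real e)"
    using eventually_at_right_less[of "0::real"] filterlim_iff[THEN iffD1, OF fl, rule_format, OF ev]
  proof eventually_elim
    case (elim e)
    have "Re (s0 + of_real e) > 1" using s0 elim by simp
    from mangoldt_series_eq[OF this elim(2)] show ?case by (simp add: right_diff_distrib)
  qed
  from that[OF m Lim_transform_eventually[OF tendsto_diff[OF L2 L1] this]] show ?thesis .
qed

lemma norm_mangoldt_series_le:
  assumes "Re s \<ge> c" "c > 1"
  shows "norm (mangoldt_series s) \<le> (\<Sum>n. (1 + ln (real n)) * real n powr (-c))"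
  unfolding mangoldt_series_def
  by (rule norm_suminf_le)
     (use norm_dirichlet_term_le[of mangoldt c s, OF mangoldt_bound assms(1)] summable_log_powr[OF assms(2)] in auto)

text \<open>
  For \<open>Re s > 1\<close> the Mangoldt series stays bounded near \<open>s\<close>, so the order of a zero has to be 0.
\<close>

lemma reg_zeta_nonzero_gt:
  assumes "Re s > 1"
  shows "reg_zeta s \<noteq> 0"
proof -
  let ?K = "\<Sum>n. (1 + ln (real n)) * real n powr (- Re s)"
  obtain m :: nat where m: "m = 0 \<longleftrightarrow> reg_zeta s \<noteq> 0"
    "((\<lambda>e. of_real e * mangoldt_series (s + of_real e)) \<longlongrightarrow> (if s = 1 then 1 else 0) - of_nat m) (at_right 0)"
    using mangoldt_series_residue[OF less_imp_le[OF assms]] by blast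
  have "((\<lambda>e. of_real e * mangoldt_series (s + of_real e)) \<longlongrightarrow> 0) (at_right 0)"
  proof (rule Lim_null_comparison)
    show "((\<lambda>e. e * ?K) \<longlongrightarrow> 0) (at_right 0)" by (auto intro!: tendsto_eq_intros)
    show "\<forall>\<^sub>F e in at_right 0. norm (of_real e * mangoldt_series (s + of_real e)) \<le> e * ?K"
      using eventually_at_right_less[of "0::real"]
    proof eventually_elim
      case (elim e)
      then show ?case using norm_mangoldt_series_le[of "Re s" "s + of_real e"] assms
        by (auto simp: norm_mult intro!: mult_left_mono)
    qed
  qed
  from tendsto_unique[OF _ this m(2)] have "m = 0" using assms by (cases "s = 1") auto
  with m(1) show ?thesis by blast
qed

text \<open>
  The inequality \<open>3 + 4 cos \<theta> + cos (2 \<theta>) = 2 (1 + cos \<theta>)\<^sup>2 \<ge> 0\<close>, summed against \<open>\<Lambda>(n) n powr (-x)\<close>.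
\<close>

lemma mangoldt_series_341:
  assumes "x > 1"
  shows "Re (3 * mangoldt_series (of_real x) + 4 * mangoldt_series (Complex x t) + mangoldt_series (Complex x (2 * t))) \<ge> 0"
proof -
  have re: "Re (mangoldt n * of_nat n powr (- Complex x u)) = mangoldt n * real n powr (-x) * cos (u * ln (real n))" for n u
  proof (cases "n = 0")
    case False
    then have "Ln (of_nat n) = of_real (ln (real n))" using Ln_of_real[of "real n"] by simp
    moreover have "mangoldt n = of_real (mangoldt n :: real)" by simp
    ultimately show ?thesis using False
      by (simp add: powr_def Re_exp algebra_simps del: of_real_mangoldt)
  qed auto
  have S: "(\<lambda>n. mangoldt n * real n powr (-x) * cos (u * ln (real n))) sums Re (mangoldt_series (Complex x u))" for u
  proof -
    have "(\<lambda>n. mangoldt n * of_nat n powr (- Complex x u)) sums mangoldt_series (Complex x u)"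
      unfolding mangoldt_series_def using assms by (intro summable_sums dirichlet_summable mangoldt_bound) auto
    from sums_Re[OF this] show ?thesis unfolding re .
  qed
  have S1: "(\<lambda>n. 3 * (mangoldt n * real n powr (-x) * cos (0 * ln (real n))) + 4 * (mangoldt n * real n powr (-x) * cos (t * ln (real n)))
         + mangoldt n * real n powr (-x) * cos ((2 * t) * ln (real n))) sums
       (3 * Re (mangoldt_series (Complex x 0)) + 4 * Re (mangoldt_series (Complex x t)) + Re (mangoldt_series (Complex x (2 * t))))"
    by (intro sums_add sums_mult S)
  have S2: "3 * (mangoldt n * real n powr (-x) * cos (0 * ln (real n))) + 4 * (mangoldt n * real n powr (-x) * cos (t * ln (real n)))
         + mangoldt n * real n powr (-x) * cos ((2 * t) * ln (real n)) \<ge> 0" for n :: nat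
  proof -
    have "cos ((2 * t) * ln (real n)) = 2 * (cos (t * ln (real n)))^2 - 1"
      using cos_double_cos[of "t * ln (real n)"] by (simp add: mult.assoc)
    then have "3 * (mangoldt n * real n powr (-x) * cos (0 * ln (real n))) + 4 * (mangoldt n * real n powr (-x) * cos (t * ln (real n)))
         + mangoldt n * real n powr (-x) * cos ((2 * t) * ln (real n)) =
         mangoldt n * real n powr (-x) * (2 * (1 + cos (t * ln (real n)))^2)"
      by (simp only:) (simp add: power2_eq_square algebra_simps)
    then show ?thesis by (simp only:) (simp add: mangoldt_nonneg)
  qed
  have "0 \<le> 3 * Re (mangoldt_series (Complex x 0)) + 4 * Re (mangoldt_series (Complex x t)) + Re (mangoldt_series (Complex x (2 * t)))"
    by (rule sums_le[OF S2 sums_zero S1])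
  then show ?thesis by (simp add: complex_of_real_def)
qed

text \<open>
  A zero of order \<open>m1\<close> at \<open>1 + i t\<close> and one of order \<open>m2\<close> at \<open>1 + 2 i t\<close> turn the previous inequality
  into \<open>3 - 4 m1 - m2 \<ge> 0\<close>, hence \<open>m1 = 0\<close>.
\<close>

lemma reg_zeta_nonzero:
  assumes "Re s \<ge> 1"
  shows "reg_zeta s \<noteq> 0"
proof (cases "Re s > 1 \<or> s = 1")
  case True
  then show ?thesis using reg_zeta_nonzero_gt reg_zeta_1 by auto
next
  case False
  define t where "t = Im s"
  have s: "s = Complex 1 t" and t: "t \<noteq> 0" using False assms by (auto simp: t_def complex_eq_iff)
  let ?L = "\<lambda>s0 e. of_real e * mangoldt_series (s0 + of_real e)"
  let ?r = "\<lambda>s0 :: complex. if s0 = 1 then 1 else (0 :: complex)"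
  let ?s2 = "Complex 1 (2 * t)"
  have re: "Re 1 \<ge> 1" "Re ?s2 \<ge> 1" by simp_all
  obtain m0 :: nat where m0: "m0 = 0 \<longleftrightarrow> reg_zeta 1 \<noteq> 0" "(?L 1 \<longlongrightarrow> ?r 1 - of_nat m0) (at_right 0)"
    by (rule mangoldt_series_residue[OF re(1)])
  obtain m1 :: nat where m1: "m1 = 0 \<longleftrightarrow> reg_zeta s \<noteq> 0" "(?L s \<longlongrightarrow> ?r s - of_nat m1) (at_right 0)"
    by (rule mangoldt_series_residue[OF assms])
  obtain m2 :: nat where m2: "(?L ?s2 \<longlongrightarrow> ?r ?s2 - of_nat m2) (at_right 0)"
    by (rule mangoldt_series_residue[OF re(2)])
  have r: "?r 1 = 1" "?r s = 0" "?r ?s2 = 0" using t by (auto simp: s complex_eq_iff)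
  have m00: "m0 = 0" using m0(1) reg_zeta_1 by simp
  have lim: "((\<lambda>e. Re (3 * ?L 1 e + 4 * ?L s e + ?L ?s2 e)) \<longlongrightarrow>
          Re (3 * (1 - of_nat m0) + 4 * (0 - of_nat m1) + (0 - of_nat m2))) (at_right 0)"
    using m0(2) m1(2) m2 unfolding r by (intro tendsto_intros)
  have nn: "\<forall>\<^sub>F e in at_right 0. Re (3 * ?L 1 e + 4 * ?L s e + ?L ?s2 e) \<ge> 0"
    using eventually_at_right_less[of "0::real"]
  proof eventually_elim
    case (elim e)
    have c: "Complex 1 u + of_real e = Complex (1 + e) u" for u by (simp add: complex_eq_iff)
    have c1: "1 + of_real e = (of_real (1 + e) :: complex)" by simp
    have "3 * ?L 1 e + 4 * ?L s e + ?L (Complex 1 (2 * t)) e =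
        of_real e * (3 * mangoldt_series (of_real (1 + e)) + 4 * mangoldt_series (Complex (1 + e) t) + mangoldt_series (Complex (1 + e) (2 * t)))"
      unfolding s c c1 by (simp add: algebra_simps)
    moreover have "Re (of_real e * w) = e * Re w" for w by simp
    ultimately have "Re (3 * ?L 1 e + 4 * ?L s e + ?L ?s2 e) = e *
       Re (3 * mangoldt_series (of_real (1 + e)) + 4 * mangoldt_series (Complex (1 + e) t) + mangoldt_series (Complex (1 + e) (2 * t)))"
      by (simp only:)
    moreover have "\<dots> \<ge> 0" using mangoldt_series_341[of "1 + e" t] elim by (intro mult_nonneg_nonneg) auto
    ultimately show ?case by (simp only:)
  qed
  have "0 \<le> Re (3 * (1 - of_nat m0) + 4 * (0 - of_nat m1) + (0 - of_nat m2))"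
    by (rule tendsto_lowerbound[OF lim nn]) simp
  then have "4 * real m1 + real m2 \<le> 3" unfolding m00 by simp
  then have "4 * m1 + m2 \<le> 3" by linarith
  then have "m1 = 0" by linarith
  then show ?thesis using m1(1) by blast
qed

text \<open>
  Subtracting \<open>\<zeta>\<close> cancels the pole at 1, so the Dirichlet series with coefficients \<open>\<Lambda>(n) - 1\<close>
  extends holomorphically across the whole line \<open>Re s = 1\<close>.
\<close>

lemma mangoldt_minus_zeta_extension:
  obtains U h where "open U" "{s. Re s \<ge> 1} \<subseteq> U" "h holomorphic_on U"
    "\<forall>s. Re s > 1 \<longrightarrow> h s = (\<Sum>n. (mangoldt n - 1) * of_nat n powr (-s))"
proof -
  let ?S = "{s. Re s > 0}"
  let ?U = "{s \<in> ?S. reg_zeta s \<noteq> 0}"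
  define p where "p = (\<lambda>z. if z = 1 then deriv reg_zeta 1 else (reg_zeta z - reg_zeta 1) / (z - 1))"
  define h where "h = (\<lambda>s. - (deriv reg_zeta s / reg_zeta s) - p s)"
  have oS: "open ?S" by (rule open_halfspace_Re_gt)
  have p: "p holomorphic_on ?S"
    unfolding p_def by (intro pole_lemma_open reg_zeta_holomorphic oS)
  have "openin (top_of_set ?S) (?S \<inter> reg_zeta -` (- {0}))"
    by (intro continuous_openin_preimage_gen holomorphic_on_imp_continuous_on reg_zeta_holomorphic) auto
  then have "open (?S \<inter> reg_zeta -` (- {0}))" using oS openin_open_trans by blast
  also have "?S \<inter> reg_zeta -` (- {0}) = ?U" by auto
  finally have oU: "open ?U" .
  have H1: "h holomorphic_on ?U" unfolding h_def
    by (intro holomorphic_intros holomorphic_on_subset[OF p] holomorphic_on_subset[OF reg_zeta_holomorphic]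
        holomorphic_on_subset[OF holomorphic_deriv[OF reg_zeta_holomorphic oS]]) auto
  have H2: "{s. Re s \<ge> 1} \<subseteq> ?U" using reg_zeta_nonzero by auto
  have H3: "h s = (\<Sum>n. (mangoldt n - 1) * of_nat n powr (-s))" if s: "Re s > 1" for s
  proof -
    have s1: "s \<noteq> 1" using s by auto
    have "(\<lambda>n. mangoldt n * of_nat n powr (-s) - 1 * of_nat n powr (-s)) sums (mangoldt_series s - zeta_series s)"
      unfolding mangoldt_series_def zeta_series_def
      using dirichlet_summable[of mangoldt s, OF mangoldt_bound s] dirichlet_summable[of "\<lambda>_. 1" s, OF one_bound s]
      by (intro sums_diff summable_sums) auto
    then have "(\<Sum>n. (mangoldt n - 1) * of_nat n powr (-s)) = mangoldt_series s - zeta_series s"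
      by (simp add: sums_iff algebra_simps)
    also have "\<dots> = h s"
    proof -
      have "p s = zeta_series s - 1 / (s - 1)"
        using s1 by (simp add: p_def reg_zeta_1 reg_zeta_eq[OF s] diff_divide_distrib)
      then show ?thesis
        by (simp add: h_def mangoldt_series_eq[OF s reg_zeta_nonzero_gt[OF s]])
    qed
    finally show ?thesis ..
  qed
  show ?thesis using that[OF oU H2 H1] H3 by blast
qed

section \<open>The Fejer kernel and oscillatory integrals\<close>

text \<open>
  The Fejer kernel of width \<open>1 / T\<close> (unnormalised: its total mass is \<open>2 \<pi>\<close> for each \<open>T\<close>). It is nonnegative, and
  it is the Fourier transform of a function supported on \<open>[-T, T]\<close>, see \<open>fejer_has_integral\<close>.
\<close>

definition fejer :: "real \<Rightarrow> real \<Rightarrow> real" where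
  "fejer T u = (if u = 0 then T else 2 * (1 - cos (T * u)) / (T * u\<^sup>2))"

lemma one_minus_cos_le: "1 - cos v \<le> v\<^sup>2 / 2" for v :: real
proof -
  have "1 - cos v = 2 * (sin (v / 2))\<^sup>2" using cos_double_sin[of "v / 2"] by simp
  also have "(sin (v / 2))\<^sup>2 \<le> (v / 2)\<^sup>2" using abs_sin_x_le_abs_x[of "v / 2"] by (simp only: abs_le_square_iff)
  finally show ?thesis by (simp add: power2_eq_square)
qed

lemma one_minus_cos_ge:
  fixes v :: real
  assumes "\<bar>v\<bar> \<le> 1"
  shows "v\<^sup>2 / 8 \<le> 1 - cos v"
proof -
  have *: "x / 2 \<le> sin x" if "0 \<le> x" "x \<le> 1/2" for x :: real
  proof -
    have "sin 0 - 0 / 2 \<le> sin x - x / 2"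
    proof (rule DERIV_nonneg_imp_nondecreasing[OF that(1)])
      fix y assume y: "0 \<le> y" "y \<le> x"
      have "y\<^sup>2 \<le> 1\<^sup>2" using y that by (intro power_mono) auto
      then have "1 / 2 \<le> cos y" using one_minus_cos_le[of y] by simp
      moreover have "((\<lambda>x. sin x - x / 2) has_real_derivative cos y - 1 / 2) (at y)"
        by (auto intro!: derivative_eq_intros)
      ultimately show "\<exists>d. ((\<lambda>x. sin x - x / 2) has_real_derivative d) (at y) \<and> 0 \<le> d" by force
    qed
    then show ?thesis by simp
  qed
  have "(\<bar>v\<bar> / 2) / 2 \<le> sin (\<bar>v\<bar> / 2)" using assms by (intro *) auto
  then have "((\<bar>v\<bar> / 2) / 2)\<^sup>2 \<le> (sin (\<bar>v\<bar> / 2))\<^sup>2" by (intro power_mono) auto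
  moreover have "1 - cos \<bar>v\<bar> = 2 * (sin (\<bar>v\<bar> / 2))\<^sup>2" using cos_double_sin[of "\<bar>v\<bar> / 2"] by simp
  ultimately show ?thesis by (simp add: power2_eq_square)
qed

lemma fejer_nonneg: "T > 0 \<Longrightarrow> fejer T u \<ge> 0"
  by (simp add: fejer_def)

lemma fejer_minus: "fejer T (-u) = fejer T u"
  by (simp add: fejer_def)

lemma fejer_le:
  assumes "T > 0"
  shows "fejer T u \<le> T"
proof (cases "u = 0")
  case False
  have "2 * (1 - cos (T * u)) \<le> T * (T * u\<^sup>2)" using one_minus_cos_le[of "T * u"]
    by (simp add: power2_eq_square algebra_simps)
  then show ?thesis using False assms by (simp add: fejer_def divide_simps algebra_simps)
qed (simp add: fejer_def)

lemma fejer_le_inverse_square: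
  assumes "T > 0" "u \<noteq> 0"
  shows "fejer T u \<le> 4 / (T * u\<^sup>2)"
proof -
  have "2 * (1 - c) \<le> 4" if "-1 \<le> c" for c :: real using that by (simp add: algebra_simps)
  from this[OF cos_ge_minus_one] have "2 * (1 - cos (T * u)) \<le> 4" .
  then show ?thesis using assms by (simp add: fejer_def divide_right_mono)
qed

lemma fejer_ge:
  assumes "T > 0" "\<bar>T * u\<bar> \<le> 1"
  shows "fejer T u \<ge> T / 4"
proof (cases "u = 0")
  case False
  have "T / 4 = 2 * ((T * u)\<^sup>2 / 8) / (T * u\<^sup>2)" using assms(1) False by (simp add: power2_eq_square)
  also have "\<dots> \<le> 2 * (1 - cos (T * u)) / (T * u\<^sup>2)"
    using one_minus_cos_ge[OF assms(2)] assms(1) by (intro divide_right_mono) auto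
  finally show ?thesis using False by (simp add: fejer_def)
qed (use assms in \<open>simp add: fejer_def\<close>)

lemma fejer_one_ge:
  assumes "\<bar>v\<bar> \<le> D" "D > 0"
  shows "2 * (1 - cos v) / D\<^sup>2 \<le> fejer 1 v"
proof (cases "v = 0")
  case False
  have "v\<^sup>2 \<le> D\<^sup>2" using assms abs_le_square_iff[of v D] by simp
  then have "2 * (1 - cos v) / D\<^sup>2 \<le> 2 * (1 - cos v) / v\<^sup>2"
    using False assms by (intro divide_left_mono) auto
  then show ?thesis using False by (simp add: fejer_def)
qed (simp add: fejer_def)

lemma fejer_one_le: "fejer 1 u \<le> 5 / (1 + u\<^sup>2)"
proof (cases "u\<^sup>2 \<le> 4")
  case True
  have p: "1 + u\<^sup>2 > 0" using zero_le_power2[of u] by linarith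
  have "fejer 1 u \<le> 1" by (rule fejer_le) simp
  also have "1 \<le> 5 / (1 + u\<^sup>2)" using True p by (simp add: field_simps)
  finally show ?thesis .
next
  case False
  then have "u \<noteq> 0" by auto
  then have "fejer 1 u \<le> 4 / u\<^sup>2" using fejer_le_inverse_square[of 1 u] by simp
  also have "\<dots> \<le> 5 / (1 + u\<^sup>2)"
  proof -
    have "4 / U \<le> 5 / (1 + U)" if "U > 4" for U :: real using that by (simp add: field_simps)
    then show ?thesis using False by (simp only: not_le)
  qed
  finally show ?thesis .
qed

text \<open>
  Away from 0, the kernel of height \<open>T\<close> is dominated by \<open>O(1 / T)\<close> times two kernels of height 1.
  A single kernel of height 1 would not do, because it has zeros; the zeros of \<open>1 - cos u\<close> are
  compensated by the translate by \<open>\<pi>\<close>, where the numerator is \<open>1 + cos u\<close>.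
\<close>

lemma fejer_tail_le:
  assumes T: "T > 0" and e: "e > 0" "\<bar>u\<bar> \<ge> e"
  shows "fejer T u \<le> (1 + 4 / e)\<^sup>2 / T * (fejer 1 u + fejer 1 (u - pi))"
proof -
  define D where "D = \<bar>u\<bar> + 4"
  have D: "D > 0" "\<bar>u\<bar> \<le> D" "\<bar>u - pi\<bar> \<le> D" using pi_less_4 pi_gt_zero unfolding D_def by linarith+
  have u: "u \<noteq> 0" using e by auto
  have "2 * (1 - cos u) / D\<^sup>2 + 2 * (1 - cos (u - pi)) / D\<^sup>2 \<le> fejer 1 u + fejer 1 (u - pi)"
    by (intro add_mono fejer_one_ge D)
  moreover have "2 * (1 - cos u) / D\<^sup>2 + 2 * (1 - cos (u - pi)) / D\<^sup>2 = 4 / D\<^sup>2"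
    by (simp add: add_divide_distrib[symmetric])
  ultimately have 1: "4 / D\<^sup>2 \<le> fejer 1 u + fejer 1 (u - pi)" by simp
  have "D \<le> \<bar>u\<bar> * (1 + 4 / e)" using e by (simp add: D_def field_simps)
  then have "D\<^sup>2 \<le> (\<bar>u\<bar> * (1 + 4 / e))\<^sup>2" using D by (intro power_mono) auto
  then have 2: "4 / u\<^sup>2 \<le> (1 + 4 / e)\<^sup>2 * (4 / D\<^sup>2)" using u D by (simp add: divide_simps power_mult_distrib algebra_simps)
  have "fejer T u \<le> 4 / u\<^sup>2 / T" using fejer_le_inverse_square[OF T u] by (simp add: mult.commute)
  also have "\<dots> \<le> (1 + 4 / e)\<^sup>2 * (fejer 1 u + fejer 1 (u - pi)) / T"
    using order_trans[OF 2 mult_left_mono[OF 1]] T by (intro divide_right_mono) auto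
  finally show ?thesis by simp
qed

lemma fejer_has_integral:
  assumes "T > 0"
  shows "((\<lambda>t. (1 - t / T) * (2 * cos (t * u))) has_integral fejer T u) {0..T}"
proof (cases "u = 0")
  case True
  have "((\<lambda>t. (1 - t / T) * 2) has_integral (2 * T - T\<^sup>2 / T) - (2 * 0 - 0\<^sup>2 / T)) {0..T}"
    by (rule fundamental_theorem_of_calculus)
       (use assms in \<open>auto intro!: derivative_eq_intros simp: has_real_derivative_iff_has_vector_derivative[symmetric] field_simps\<close>)
  then show ?thesis using True assms by (simp add: fejer_def power2_eq_square)
next
  case False
  let ?F = "\<lambda>t. (1 - t / T) * (2 * sin (t * u) / u) - 2 * cos (t * u) / (T * u\<^sup>2)"
  have "((\<lambda>t. (1 - t / T) * (2 * cos (t * u))) has_integral ?F T - ?F 0) {0..T}"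
    by (rule fundamental_theorem_of_calculus)
       (use assms False in \<open>auto intro!: derivative_eq_intros simp: has_real_derivative_iff_has_vector_derivative[symmetric] power2_eq_square\<close>,
        (simp add: field_simps)?)
  also have "?F T - ?F 0 = fejer T u" using False assms by (simp add: fejer_def diff_divide_distrib)
  finally show ?thesis .
qed

text \<open>
  A quantitative Riemann-Lebesgue lemma: one integration by parts gains a factor \<open>1 / z\<close>. The bound is
  uniform in the abscissa \<open>x\<close>, because \<open>h\<close> and its derivative are bounded on the compact rectangle
  \<open>[1, 2] \<times> [0, T]\<close>.
\<close>

lemma oscillatory_integral_bound:
  assumes hol: "h holomorphic_on U" "open U" "{s. Re s \<ge> 1} \<subseteq> U" and T: "T > 0"
  obtains C where "C > 0" "\<forall>x\<in>{1..2}. \<forall>z>0.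
    norm (integral {0..T} (\<lambda>t. of_real (1 - t / T) * cis (t * z) * h (Complex x t))) \<le> C / z"
proof -
  let ?K = "cbox (Complex 1 0) (Complex 2 T)"
  have KU: "?K \<subseteq> U" using hol(3) by (auto simp: in_cbox_complex_iff)
  have hol': "deriv h holomorphic_on U" by (rule holomorphic_deriv[OF hol(1,2)])
  have "bounded (h ` ?K)" "bounded (deriv h ` ?K)"
    by (intro compact_imp_bounded compact_continuous_image holomorphic_on_imp_continuous_on compact_cbox
          holomorphic_on_subset[OF hol(1) KU] holomorphic_on_subset[OF hol' KU])+
  then obtain B1 B2 where B1: "\<And>s. s \<in> ?K \<Longrightarrow> norm (h s) \<le> B1" and B2: "\<And>s. s \<in> ?K \<Longrightarrow> norm (deriv h s) \<le> B2"
    unfolding bounded_iff by blast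
  define B where "B = max 1 (max B1 B2)"
  have B: "B > 0" "\<And>s. s \<in> ?K \<Longrightarrow> norm (h s) \<le> B" "\<And>s. s \<in> ?K \<Longrightarrow> norm (deriv h s) \<le> B"
    using B1 B2 by (force simp: B_def)+
  show ?thesis
  proof (rule that[of "B + (B / T + B) * T"])
    show "B + (B / T + B) * T > 0" using B T by (simp add: add_pos_pos)
  next
    show "\<forall>x\<in>{1..2}. \<forall>z>0. norm (integral {0..T} (\<lambda>t. of_real (1 - t / T) * cis (t * z) * h (Complex x t)))
            \<le> (B + (B / T + B) * T) / z"
    proof (intro ballI allI impI)
    fix x z :: real assume x: "x \<in> {1..2}" and z: "z > 0"
    let ?G = "\<lambda>t. of_real (1 - t / T) * h (Complex x t)"
    let ?G' = "\<lambda>t. - of_real (1 / T) * h (Complex x t) + of_real (1 - t / T) * (deriv h (Complex x t) * \<i>)"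
    let ?e = "\<lambda>t. cis (t * z)"
    have inK: "Complex x t \<in> ?K" if "t \<in> {0..T}" for t
      using that x by (auto simp: in_cbox_complex_iff)
    have dh: "((\<lambda>t. h (Complex x t)) has_vector_derivative (deriv h (Complex x t) * \<i>)) (at t within {0..T})" if "t \<in> {0..T}" for t
    proof -
      have 1: "(h has_field_derivative deriv h (Complex x t)) (at (Complex x t))"
        using holomorphic_derivI[OF hol(1,2)] KU inK[OF that] by blast
      have 2: "((\<lambda>t. Complex x t) has_vector_derivative \<i>) (at t within {0..T})"
        unfolding Complex_eq by (auto intro!: derivative_eq_intros)
      from field_vector_diff_chain_within[OF 2 has_field_derivative_at_within[OF 1]]
      show ?thesis by (simp add: o_def mult.commute)
    qed
    have de: "((\<lambda>t. ?e t / (\<i> * of_real z)) has_vector_derivative ?e t) (at t within {0..T})" for t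
    proof -
      have "((\<lambda>w. exp (\<i> * of_real z * w) / (\<i> * of_real z)) has_field_derivative exp (\<i> * of_real z * of_real t)) (at (of_real t))"
        using z by (auto intro!: derivative_eq_intros)
      from has_vector_derivative_real_field[OF this, of "{0..T}"] show ?thesis by (simp add: cis_conv_exp mult_ac o_def)
    qed
    have dG: "(?G has_vector_derivative ?G' t) (at t within {0..T})" if "t \<in> {0..T}" for t
      using T by (auto intro!: derivative_eq_intros dh[OF that] simp: algebra_simps add_divide_distrib)
    have "((\<lambda>t. ?G t * ?e t + ?G' t * (?e t / (\<i> * of_real z))) has_integral
            ?G T * (?e T / (\<i> * of_real z)) - ?G 0 * (?e 0 / (\<i> * of_real z))) {0..T}"
      using T by (intro fundamental_theorem_of_calculus has_vector_derivative_mult dG de) auto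
    then have I: "((\<lambda>t. ?G t * ?e t + ?G' t * (?e t / (\<i> * of_real z))) has_integral - (h (Complex x 0) / (\<i> * of_real z))) {0..T}"
      using T by simp
    have ch: "continuous_on {0..T} (\<lambda>t. h (Complex x t))"
      using dh has_vector_derivative_continuous by (force simp: continuous_on_eq_continuous_within)
    have cd: "continuous_on {0..T} (\<lambda>t. deriv h (Complex x t))"
    proof (rule continuous_on_compose2[of ?K "deriv h" _ "\<lambda>t. Complex x t"])
      show "continuous_on ?K (deriv h)" by (intro holomorphic_on_imp_continuous_on holomorphic_on_subset[OF hol' KU])
      show "continuous_on {0..T} (\<lambda>t. Complex x t)" unfolding Complex_eq by (intro continuous_intros)
    qed (use inK in auto)
    have int2: "(\<lambda>t. ?G' t * (?e t / (\<i> * of_real z))) integrable_on {0..T}"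
      using T z by (intro integrable_continuous_real continuous_intros ch cd) auto
    have nb: "norm (integral {0..T} (\<lambda>t. ?G' t * (?e t / (\<i> * of_real z)))) \<le> ((B / T + B) / z) * (T - 0)"
    proof (rule integral_bound)
      show "continuous_on {0..T} (\<lambda>t. ?G' t * (?e t / (\<i> * of_real z)))"
        using T z by (intro continuous_intros ch cd) auto
      fix t assume t: "t \<in> {0..T}"
      have "norm (- of_real (1 / T) * h (Complex x t)) \<le> (1 / T) * B"
        using B(2)[OF inK[OF t]] T by (simp add: norm_mult norm_divide divide_right_mono)
      moreover have "norm (of_real (1 - t / T) * (deriv h (Complex x t) * \<i>)) \<le> 1 * (B * 1)"
      proof -
        have "norm (of_real (1 - t / T) :: complex) \<le> 1"
          unfolding norm_of_real using t T by (auto simp: divide_simps abs_le_iff)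
        then show ?thesis
          unfolding norm_mult using B(3)[OF inK[OF t]] B(1) by (intro mult_mono) auto
      qed
      ultimately have "norm (?G' t) \<le> B / T + B" 
        by (intro order_trans[OF norm_triangle_ineq]) simp
      then have "norm (?G' t) * (1 / z) \<le> (B / T + B) * (1 / z)" using z by (intro mult_right_mono) auto
      moreover have "norm (?G' t * (?e t / (\<i> * of_real z))) = norm (?G' t) * (1 / z)"
        unfolding norm_mult norm_divide using z by simp
      ultimately show "norm (?G' t * (?e t / (\<i> * of_real z))) \<le> (B / T + B) / z" by simp
    qed (use T in auto)
    have "((\<lambda>t. ?G t * ?e t) has_integral (- (h (Complex x 0) / (\<i> * of_real z)) - integral {0..T} (\<lambda>t. ?G' t * (?e t / (\<i> * of_real z))))) {0..T}"
      using has_integral_diff[OF I integrable_integral[OF int2]] by simp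
    then have "integral {0..T} (\<lambda>t. of_real (1 - t / T) * cis (t * z) * h (Complex x t)) =
       - (h (Complex x 0) / (\<i> * of_real z)) - integral {0..T} (\<lambda>t. ?G' t * (?e t / (\<i> * of_real z)))"
      by (intro integral_unique) (simp add: mult_ac)
    also have "norm \<dots> \<le> B / z + ((B / T + B) / z) * (T - 0)"
    proof (rule order_trans[OF norm_triangle_ineq4 add_mono[OF _ nb]])
      show "norm (- (h (Complex x 0) / (\<i> * of_real z))) \<le> B / z"
        using B(2)[OF inK[of 0]] T z by (simp add: norm_divide norm_mult divide_right_mono)
    qed
    also have "\<dots> = (B + (B / T + B) * T) / z" using T z by (simp add: field_simps)
    finally show "norm (integral {0..T} (\<lambda>t. of_real (1 - t / T) * cis (t * z) * h (Complex x t))) \<le> (B + (B / T + B) * T) / z" .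
    qed
  qed
qed

text \<open>
  A sum of Dirichlet coefficients weighted by a Fejer kernel on the logarithmic scale is an integral of
  the Dirichlet series over a bounded vertical segment. Only the upper half \<open>[0, T]\<close> is needed, as the
  coefficients are real.
\<close>

lemma dirichlet_fejer_sums:
  assumes a: "\<And>n. n > 0 \<Longrightarrow> \<bar>a n\<bar> \<le> 1 + ln (real n)" and x: "x > 1" and T: "T > 0"
  shows "(\<lambda>n. a n * real n powr (-x) * fejer T (ln (real n) - z)) sums
     (2 * Re (integral {0..T} (\<lambda>t. of_real (1 - t / T) * cis (t * z) *
        (\<Sum>n. of_real (a n) * of_nat n powr (- Complex x t)))))"
proof -
  define d :: "nat \<Rightarrow> real \<Rightarrow> complex" where "d = (\<lambda>n t. of_real (a n) * of_nat n powr (- Complex x t))"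
  define w :: "real \<Rightarrow> complex" where "w = (\<lambda>t. of_real (1 - t / T) * cis (t * z))"
  define g where "g = (\<lambda>n t. w t * d n t)"
  have a': "n > 0 \<Longrightarrow> norm (of_real (a n) :: complex) \<le> 1 + ln (real n)" for n using a by simp
  have cont: "continuous_on {0..T} (g n)" for n
    unfolding g_def w_def d_def
    using T by (cases "n = 0") (auto simp: Complex_eq intro!: continuous_intros)
  have sd: "summable (\<lambda>n. d n t)" for t unfolding d_def using dirichlet_summable[of "\<lambda>n. of_real (a n)", OF a'] x by simp
  have "uniform_limit {0..T} (\<lambda>N t. \<Sum>n<N. g n t) (\<lambda>t. \<Sum>n. g n t) sequentially"
  proof (rule Weierstrass_m_test[OF _ summable_log_powr[OF x]])
    fix n t assume t: "t \<in> {0..T}"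
    have "norm (g n t) = \<bar>1 - t / T\<bar> * norm (d n t)" by (simp add: g_def w_def norm_mult del: of_real_diff)
    also have "\<dots> \<le> 1 * ((1 + ln (real n)) * real n powr (-x))"
      using t T norm_dirichlet_term_le[of "\<lambda>n. of_real (a n)" x "Complex x t", OF a']
      unfolding d_def by (intro mult_mono) (auto simp: divide_simps abs_le_iff)
    finally show "norm (g n t) \<le> (1 + ln (real n)) * real n powr (-x)" by simp
  qed
  then have ul: "uniform_limit (cbox 0 T) (\<lambda>N t. \<Sum>n<N. g n t) (\<lambda>t. w t * (\<Sum>n. d n t)) sequentially"
    using suminf_mult[OF sd] by (simp add: g_def)
  obtain I J where I: "\<And>N. ((\<lambda>t. \<Sum>n<N. g n t) has_integral I N) (cbox 0 T)"
    and J: "((\<lambda>t. w t * (\<Sum>n. d n t)) has_integral J) (cbox 0 T)" and lim: "I \<longlonglongrightarrow> J"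
    by (rule uniform_limit_integral_cbox[OF ul])
       (auto intro!: continuous_on_sum cont)
  have tm: "2 * Re (integral {0..T} (g n)) = a n * real n powr (-x) * fejer T (ln (real n) - z)" for n
  proof (cases "n = 0")
    case False
    have ln: "Ln (of_nat n) = of_real (ln (real n))" using False Ln_of_real[of "real n"] by simp
    have "Re (g n t) = a n * real n powr (-x) * ((1 - t / T) * cos (t * (z - ln (real n))))" for t
    proof -
      have "g n t = of_real (a n * (1 - t / T)) * (cis (t * z) * exp (- Complex x t * of_real (ln (real n))))"
        using False by (simp add: g_def w_def d_def powr_def ln)
      also have "exp (- Complex x t * of_real (ln (real n))) = of_real (real n powr (-x)) * cis (- (t * ln (real n)))"
        using False by (simp add: complex_eq_iff Re_exp Im_exp powr_def)
      also have "cis (t * z) * (of_real (real n powr (-x)) * cis (- (t * ln (real n)))) =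
          of_real (real n powr (-x)) * cis (t * (z - ln (real n)))"
        by (simp add: cis_mult algebra_simps)
      finally have "g n t = of_real (a n * (1 - t / T) * real n powr (-x)) * cis (t * (z - ln (real n)))"
        by simp
      then show ?thesis by (simp only: Re_complex_of_real Im_complex_of_real times_complex.sel cis.sel) simp
    qed
    moreover have "((\<lambda>t. Re (g n t)) has_integral Re (integral {0..T} (g n))) {0..T}"
      by (intro has_integral_Re integrable_integral integrable_continuous_real cont)
    ultimately have "((\<lambda>t. a n * real n powr (-x) * ((1 - t / T) * cos (t * (z - ln (real n))))) has_integral
       Re (integral {0..T} (g n))) {0..T}" by simp
    from has_integral_mult_right[OF this, of 2]
    have 1: "((\<lambda>t. a n * real n powr (-x) * ((1 - t / T) * (2 * cos (t * (z - ln (real n)))))) has_integral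
       2 * Re (integral {0..T} (g n))) {0..T}" by (simp add: mult_ac)
    have 2: "((\<lambda>t. a n * real n powr (-x) * ((1 - t / T) * (2 * cos (t * (z - ln (real n)))))) has_integral
       a n * real n powr (-x) * fejer T (z - ln (real n))) {0..T}"
      by (intro has_integral_mult_right fejer_has_integral T)
    from has_integral_unique[OF 1 2] show ?thesis using fejer_minus[of T "z - ln (real n)"] by simp
  qed (auto simp: g_def d_def)
  have IN: "I N = (\<Sum>n<N. integral {0..T} (g n))" for N
    using has_integral_unique[OF I[of N, unfolded cbox_interval]
        has_integral_sum[of "{..<N}" g "\<lambda>n. integral {0..T} (g n)" "{0..T}"]]
    by (simp add: integrable_integral integrable_continuous_real cont)
  have "(\<lambda>n. integral {0..T} (g n)) sums J" using lim unfolding sums_def IN[abs_def] .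
  from sums_mult[OF sums_Re[OF this], of 2] show ?thesis
    unfolding tm using integral_unique[OF J] by (simp add: w_def d_def)
qed

text \<open>
  Seen through a fixed Fejer kernel centred at \<open>z\<close> on the logarithmic scale, the weights \<open>\<Lambda>(n)\<close> and 1
  agree up to \<open>O(1 / z)\<close>.
\<close>

lemma mangoldt_fejer_diff:
  assumes T: "T > 0"
  obtains C where "C > 0" "\<forall>x\<in>{1<..2}. \<forall>z>0.
    \<bar>\<Sum>n. (mangoldt n - 1) * real n powr (-x) * fejer T (ln (real n) - z)\<bar> \<le> C / z"
proof -
  obtain U h where h: "open U" "{s. Re s \<ge> 1} \<subseteq> U" "h holomorphic_on U"
    "\<forall>s. Re s > 1 \<longrightarrow> h s = (\<Sum>n. (mangoldt n - 1) * of_nat n powr (-s))"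
    by (rule mangoldt_minus_zeta_extension)
  obtain C where C: "C > 0" "\<forall>x\<in>{1..2}. \<forall>z>0.
    norm (integral {0..T} (\<lambda>t. of_real (1 - t / T) * cis (t * z) * h (Complex x t))) \<le> C / z"
    by (rule oscillatory_integral_bound[OF h(3,1,2) T])
  show ?thesis
  proof (rule that[of "2 * C"])
    show "2 * C > 0" using C by simp
  next
    show "\<forall>x\<in>{1<..2}. \<forall>z>0. \<bar>\<Sum>n. (mangoldt n - 1) * real n powr (-x) * fejer T (ln (real n) - z)\<bar> \<le> 2 * C / z"
    proof (intro ballI allI impI)
    fix x z :: real assume "x \<in> {1<..2}" and z: "z > 0"
    then have x: "x > 1" "x \<le> 2" by auto
    have b: "\<bar>mangoldt n - 1\<bar> \<le> 1 + ln (real n)" if "n > 0" for n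
      using mangoldt_le[OF that] mangoldt_nonneg[of n] that by (simp add: abs_le_iff)
    have "(\<Sum>n. (mangoldt n - 1) * real n powr (-x) * fejer T (ln (real n) - z)) =
       2 * Re (integral {0..T} (\<lambda>t. of_real (1 - t / T) * cis (t * z) * h (Complex x t)))"
      using dirichlet_fejer_sums[of "\<lambda>n. mangoldt n - 1", OF b x(1) T, of z] h(4) x
      by (simp add: sums_iff)
    also have "\<bar>\<dots>\<bar> \<le> 2 * (C / z)"
      using C(2)[rule_format, of x z] x z abs_Re_le_cmod[of "integral {0..T} (\<lambda>t. of_real (1 - t / T) * cis (t * z) * h (Complex x t))"]
      by (simp add: abs_mult)
    finally show "\<bar>\<Sum>n. (mangoldt n - 1) * real n powr (-x) * fejer T (ln (real n) - z)\<bar> \<le> 2 * C / z" by simp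
    qed
  qed
qed

section \<open>Primes in short intervals\<close>

lemma mangoldt_abs_bound: "n > 0 \<Longrightarrow> \<bar>mangoldt n\<bar> \<le> 1 + ln (real n)"
  using mangoldt_le[of n] by simp

lemma fejer_mangoldt_summable:
  assumes "x > 1" "T > 0"
  shows "summable (\<lambda>n. mangoldt n * real n powr (-x) * fejer T (ln (real n) - z))"
  using dirichlet_fejer_sums[OF mangoldt_abs_bound assms] by (rule sums_summable)

lemma fejer_one_summable:
  assumes "x > 1" "T > 0"
  shows "summable (\<lambda>n. real n powr (-x) * fejer T (ln (real n) - z))"
  using sums_summable[OF dirichlet_fejer_sums[of "\<lambda>_. 1", OF _ assms]] by simp

text \<open>
  The summands of the kernel of height 1 are compared with increments of \<open>arctan (ln t - z)\<close>, which
  telescope to at most \<open>\<pi>\<close>.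
\<close>

lemma fejer_term_le_arctan_diff:
  assumes x: "x > 1"
  shows "real n powr (-x) * fejer 1 (ln (real n) - z) \<le> 30 * (arctan (ln (real (Suc n)) - z) - arctan (ln (real n) - z))"
proof (cases "n = 0")
  case False
  then have n: "real n \<ge> 1" by simp
  define u where "u = ln (real n) - z"
  have "\<exists>\<xi>. real n < \<xi> \<and> \<xi> < real (Suc n) \<and>
      arctan (ln (real (Suc n)) - z) - arctan (ln (real n) - z) = (real (Suc n) - real n) * (1 / (\<xi> * (1 + (ln \<xi> - z)\<^sup>2)))"
  proof (rule MVT2)
    fix t assume "real n \<le> t" "t \<le> real (Suc n)"
    then show "((\<lambda>t. arctan (ln t - z)) has_real_derivative 1 / (t * (1 + (ln t - z)\<^sup>2))) (at t)"
      using n by (auto intro!: derivative_eq_intros simp: field_simps)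
  qed simp
  then obtain \<xi> where \<xi>: "real n < \<xi>" "\<xi> < real n + 1"
    and eq: "arctan (ln (real (Suc n)) - z) - arctan (ln (real n) - z) = 1 / (\<xi> * (1 + (ln \<xi> - z)\<^sup>2))"
    by auto
  have "ln (\<xi> / real n) \<le> \<xi> / real n - 1" using \<xi> n by (intro ln_le_minus_one) auto
  also have "\<dots> \<le> 1" using \<xi> n by (simp add: field_simps)
  finally have d1: "ln \<xi> - ln (real n) \<le> 1" using \<xi> n by (simp add: ln_div)
  have d0: "ln \<xi> - ln (real n) \<ge> 0" using \<xi> n by simp
  define v where "v = ln \<xi> - ln (real n)"
  have v: "v\<^sup>2 \<le> 1" using d0 d1 by (auto simp: v_def intro: power_le_one)
  have "ln \<xi> - z = u + v" by (simp add: u_def v_def)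
  then have "(ln \<xi> - z)\<^sup>2 \<le> 2 * u\<^sup>2 + 2 * v\<^sup>2"
    using zero_le_power2[of "u - v"] by (simp add: power2_eq_square algebra_simps)
  then have "1 + (ln \<xi> - z)\<^sup>2 \<le> 3 + 3 * u\<^sup>2" using v zero_le_power2[of u] by linarith
  then have "1 + (ln \<xi> - z)\<^sup>2 \<le> 3 * (1 + u\<^sup>2)" by (simp add: distrib_left)
  moreover have "\<xi> \<le> 2 * real n" using \<xi> n by simp
  ultimately have "\<xi> * (1 + (ln \<xi> - z)\<^sup>2) \<le> (2 * real n) * (3 * (1 + u\<^sup>2))"
    using \<xi> n by (intro mult_mono) auto
  moreover have "0 < \<xi> * (1 + (ln \<xi> - z)\<^sup>2)" using \<xi> n by (intro mult_pos_pos) (auto intro: add_pos_nonneg)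
  ultimately have "1 / ((2 * real n) * (3 * (1 + u\<^sup>2))) \<le> 1 / (\<xi> * (1 + (ln \<xi> - z)\<^sup>2))"
    by (intro frac_le) auto
  moreover have "1 / ((2 * real n) * (3 * (1 + u\<^sup>2))) = 1 / (real n * (1 + u\<^sup>2)) / 6"
    by (simp only: divide_divide_eq_left) (simp add: mult_ac)
  moreover have "a \<le> 6 * b" if "a / 6 \<le> b" for a b :: real using that by simp
  ultimately have *: "1 / (real n * (1 + u\<^sup>2)) \<le> 6 * (1 / (\<xi> * (1 + (ln \<xi> - z)\<^sup>2)))" by metis
  have "real n powr (-x) \<le> real n powr (-1)" using x n by (intro powr_mono) auto
  also have "\<dots> = 1 / real n" using n by (simp add: powr_minus_divide)
  finally have "real n powr (-x) * fejer 1 u \<le> 1 / real n * (5 / (1 + u\<^sup>2))"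
    using fejer_one_le[of u] by (intro mult_mono) (auto simp: fejer_nonneg)
  also have "\<dots> = 5 * (1 / (real n * (1 + u\<^sup>2)))" by simp
  also have "\<dots> \<le> 5 * (6 * (1 / (\<xi> * (1 + (ln \<xi> - z)\<^sup>2))))" by (intro mult_left_mono *) simp
  finally show ?thesis unfolding eq u_def by simp
qed simp

text \<open>
  An upper bound that depends neither on the centre \<open>z\<close> nor on the abscissa \<open>x\<close>.
\<close>

lemma fejer_one_sum_le:
  assumes x: "x > 1"
  shows "(\<Sum>n. real n powr (-x) * fejer 1 (ln (real n) - z)) \<le> 30 * pi"
proof (rule suminf_le_const)
  show "summable (\<lambda>n. real n powr (-x) * fejer 1 (ln (real n) - z))"
    by (intro fejer_one_summable x) simp
  fix N
  let ?A = "\<lambda>n. arctan (ln (real n) - z)"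
  have "(\<Sum>n<N. real n powr (-x) * fejer 1 (ln (real n) - z)) \<le> (\<Sum>n<N. 30 * (?A (Suc n) - ?A n))"
    by (intro sum_mono fejer_term_le_arctan_diff x)
  also have "\<dots> = 30 * (?A N - ?A 0)"
    using sum_lessThan_telescope[of ?A N] by (simp only: sum_distrib_left[symmetric])
  also have "\<dots> \<le> 30 * pi"
  proof -
    have "?A N < pi / 2" "- (pi / 2) < ?A 0" by (rule arctan_ubound arctan_lbound)+
    then have "?A N - ?A 0 \<le> pi" by linarith
    then show ?thesis by simp
  qed
  finally show "(\<Sum>n<N. real n powr (-x) * fejer 1 (ln (real n) - z)) \<le> 30 * pi" .
qed

text \<open>
  A lower bound that depends neither on the height \<open>T\<close> nor on the centre \<open>y\<close>: there are about
  \<open>exp y / T\<close> integers \<open>n\<close> with \<open>y \<le> ln n \<le> y + 1 / T\<close>, and each contributes at least a constant times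
  \<open>T exp (-y)\<close>. The abscissa \<open>1 + 1 / y\<close> is so close to 1 that it costs only a constant factor.
\<close>

lemma fejer_sum_ge:
  assumes T: "T \<ge> 1" and y: "y \<ge> 1" "exp y \<ge> 2 * T"
  shows "exp (-3) / 8 \<le> (\<Sum>n. real n powr (-(1 + 1 / y)) * fejer T (ln (real n) - y))"
proof -
  define a where "a = exp y"
  define b where "b = exp (y + 1 / T)"
  define N where "N = {nat \<lceil>a\<rceil>..nat \<lfloor>b\<rfloor>}"
  have a0: "a > 0" by (simp add: a_def)
  have "a * (1 + 1 / T) \<le> a * exp (1 / T)" using a0 exp_ge_add_one_self[of "1 / T"] by (intro mult_left_mono) auto
  then have ba: "b - a \<ge> a / T" by (simp add: a_def b_def exp_add algebra_simps)
  have aT: "a / T \<ge> 2" using y T by (simp add: a_def field_simps)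
  have card: "real (card N) \<ge> a / (2 * T)"
  proof -
    have fc: "\<lceil>a\<rceil> \<le> \<lfloor>b\<rfloor> + 1" using ba aT by linarith
    have "real (card N) = real_of_int (\<lfloor>b\<rfloor> + 1 - \<lceil>a\<rceil>)"
    proof -
      have "\<lceil>a\<rceil> \<ge> 0" "\<lfloor>b\<rfloor> \<ge> 0" using a0 by (auto simp: b_def)
      then have "int (card N) = \<lfloor>b\<rfloor> + 1 - \<lceil>a\<rceil>" using fc unfolding N_def card_atLeastAtMost by linarith
      then show ?thesis by (metis of_int_of_nat_eq)
    qed
    also have "\<dots> \<ge> b - a - 1" by linarith
    finally show ?thesis using ba aT by (simp add: field_simps)
  qed
  have el: "exp (-y) * exp (-3) * (T / 4) \<le> real n powr (-(1 + 1 / y)) * fejer T (ln (real n) - y)" if "n \<in> N" for n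
  proof -
    have n: "a \<le> real n" "real n \<le> b" using that a0 unfolding N_def
      by (auto simp: nat_le_iff le_nat_iff ceiling_le_iff le_floor_iff b_def)
    then have n0: "real n > 0" using a0 by linarith
    have l1: "y \<le> ln (real n)" using n(1) unfolding a_def ln_ge_iff[OF n0] .
    have "ln (real n) \<le> ln b" using n(2) n0 by (intro ln_mono) auto
    then have l2: "ln (real n) \<le> y + 1 / T" by (simp add: b_def)
    note l = l1 l2
    have "(1 + 1 / y) * ln (real n) \<le> (1 + 1 / y) * (y + 1 / T)"
      using l y by (intro mult_left_mono) auto
    also have "\<dots> = y + 1 + (1 / T) * (1 + 1 / y)" using y T by (simp add: field_simps)
    also have "\<dots> \<le> y + 1 + 1 * (1 + 1)" using y T by (intro add_left_mono mult_mono) auto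
    finally have "exp (- (y + 3)) \<le> real n powr (-(1 + 1 / y))" using n0 by (simp add: powr_def algebra_simps)
    then have "exp (-y) * exp (-3) \<le> real n powr (-(1 + 1 / y))" by (simp add: exp_add[symmetric])
    moreover have "T / 4 \<le> fejer T (ln (real n) - y)"
    proof (rule fejer_ge)
      have "T * \<bar>ln (real n) - y\<bar> \<le> T * (1 / T)" using l T by (intro mult_left_mono) auto
      then show "\<bar>T * (ln (real n) - y)\<bar> \<le> 1" using T by (simp add: abs_mult)
    qed (use T in auto)
    ultimately show ?thesis using T by (intro mult_mono) auto
  qed
  have "exp (-3) / 8 = a / (2 * T) * (exp (-y) * exp (-3) * (T / 4))"
    using T by (simp add: a_def exp_minus)
  also have "\<dots> \<le> real (card N) * (exp (-y) * exp (-3) * (T / 4))"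
    using card T by (intro mult_right_mono) auto
  also have "\<dots> = (\<Sum>n\<in>N. exp (-y) * exp (-3) * (T / 4))" by simp
  also have "\<dots> \<le> (\<Sum>n\<in>N. real n powr (-(1 + 1 / y)) * fejer T (ln (real n) - y))"
    by (intro sum_mono el)
  also have "\<dots> \<le> (\<Sum>n. real n powr (-(1 + 1 / y)) * fejer T (ln (real n) - y))"
  proof (rule sum_le_suminf)
    show "summable (\<lambda>n. real n powr (-(1 + 1 / y)) * fejer T (ln (real n) - y))"
      using T y by (intro fejer_one_summable) auto
  qed (use T in \<open>auto simp: N_def fejer_nonneg\<close>)
  finally show ?thesis .
qed

lemma card_proper_prime_powers_le:
  assumes "y \<ge> 0"
  shows "finite {n. n > 0 \<and> ln (real n) \<le> y \<and> primepow n \<and> \<not> prime n}" (is "finite ?E")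
    and "real (card {n. n > 0 \<and> ln (real n) \<le> y \<and> primepow n \<and> \<not> prime n}) \<le> (exp (y / 2) + 1) * (2 * y + 1)"
proof -
  let ?P = "{..nat \<lfloor>exp (y / 2)\<rfloor>} \<times> {..nat \<lfloor>2 * y\<rfloor>}"
  have sub: "?E \<subseteq> (\<lambda>(p, k). p ^ k) ` ?P"
  proof
    fix n assume "n \<in> ?E"
    then have n: "n > 0" "ln (real n) \<le> y" "primepow n" "\<not> prime n" by auto
    then obtain p k where pk: "prime p" "k > 0" "n = p ^ k" unfolding primepow_def by auto
    have "k \<noteq> 1" using pk n(4) by auto
    then have k2: "k \<ge> 2" using pk(2) by linarith
    have p2: "real p \<ge> 2" using prime_ge_2_nat[OF pk(1)] by simp
    have ln: "ln (real n) = real k * ln (real p)" using p2 by (simp add: pk(3) ln_realpow)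
    have l2: "ln (2::real) \<ge> 1 / 2" using ln2_ge_two_thirds by linarith
    have lp: "ln 2 \<le> ln (real p)" using p2 by simp
    have "2 * ln (real p) \<le> real k * ln (real p)" using k2 lp l2 by (intro mult_right_mono) auto
    then have "ln (real p) \<le> y / 2" using n(2) ln by simp
    then have "real p \<le> exp (y / 2)" using p2 ln_le_cancel_iff[of "real p" "exp (y / 2)"] by simp
    moreover have "real k * (1 / 2) \<le> real k * ln (real p)" using lp l2 by (intro mult_left_mono) auto
    then have "real k \<le> 2 * y" using n(2) ln by simp
    ultimately have "(p, k) \<in> ?P" by (auto simp: le_nat_floor)
    then show "n \<in> (\<lambda>(p, k). p ^ k) ` ?P" using pk(3) by force
  qed
  show fin: "finite ?E" by (rule finite_subset[OF sub]) auto
  have "card ?E \<le> card ?P" by (rule surj_card_le[OF _ sub]) auto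
  also have "\<dots> = (nat \<lfloor>exp (y / 2)\<rfloor> + 1) * (nat \<lfloor>2 * y\<rfloor> + 1)" by simp
  finally have "real (card ?E) \<le> (real (nat \<lfloor>exp (y / 2)\<rfloor>) + 1) * (real (nat \<lfloor>2 * y\<rfloor>) + 1)"
    by (simp only: of_nat_le_iff[symmetric, where ?'a = real] of_nat_mult of_nat_add of_nat_1)
  also have "\<dots> \<le> (exp (y / 2) + 1) * (2 * y + 1)"
    using assms by (intro mult_mono add_right_mono of_nat_floor) auto
  finally show "real (card ?E) \<le> (exp (y / 2) + 1) * (2 * y + 1)" .
qed

text \<open>
  For large \<open>x\<close> there is a prime between \<open>exp (-e) x\<close> and \<open>exp e x\<close>. The kernel of height \<open>T\<close> centred at
  \<open>y = ln x\<close> captures a mass at least \<open>c\<close>. Without such a prime, this mass comes from proper prime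
  powers, which are too rare to matter, and from the tail of the kernel, which is \<open>O(1 / T)\<close>
  by the comparison with two kernels of height 1. A large enough \<open>T\<close> gives a contradiction.
\<close>

theorem eventually_prime_ln_near:
  fixes e :: real
  assumes "e > 0"
  shows "\<forall>\<^sub>F y in at_top. \<exists>p::nat. prime p \<and> \<bar>ln (real p) - y\<bar> < e"
proof -
  define d where "d = min e 1"
  have d: "d > 0" "d \<le> 1" "d \<le> e" using assms by (auto simp: d_def)
  define A where "A = (1 + 4 / d)\<^sup>2"
  define c where "c = exp (-3) / (8 :: real)"
  define K where "K = 2 * (30 * pi + 1)"
  define T where "T = max 1 (4 * A * K / c)"
  have c0: "c > 0" and A0: "A \<ge> 0" and K0: "K > 0" by (auto simp: c_def A_def K_def intro: add_pos_pos)
  have T1: "T \<ge> 1" and T0: "T > 0" by (auto simp: T_def)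
  have "4 * A * K / c \<le> T" by (simp add: T_def)
  then have AT: "A / T * K \<le> c / 4" using c0 T0 by (simp add: field_simps)
  obtain CT where CT: "CT > 0" "\<forall>x\<in>{1<..2}. \<forall>z>0.
    \<bar>\<Sum>n. (mangoldt n - 1) * real n powr (-x) * fejer T (ln (real n) - z)\<bar> \<le> CT / z"
    by (rule mangoldt_fejer_diff[OF T0])
  obtain C1 where C1: "C1 > 0" "\<forall>x\<in>{1<..2}. \<forall>z>0.
    \<bar>\<Sum>n. (mangoldt n - 1) * real n powr (-x) * fejer 1 (ln (real n) - z)\<bar> \<le> C1 / z"
    by (rule mangoldt_fejer_diff[OF zero_less_one])
  \<comment> \<open>B bounds the contribution of a single proper prime power, Q the contribution of all of them.\<close>
  define B where "B = (\<lambda>y. T * ((y + 1) * exp (1 - y)))"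
  define Q where "Q = (\<lambda>y. (exp ((y + 1) / 2) + 1) * (2 * (y + 1) + 1) * B y)"
  have "\<forall>\<^sub>F y in at_top. (1::real) \<le> y" "\<forall>\<^sub>F y in at_top. exp y \<ge> 2 * T"
    "\<forall>\<^sub>F y in at_top. CT / y < c / 4" "\<forall>\<^sub>F y in at_top. C1 / y < 1"
    "\<forall>\<^sub>F y in at_top. Q y < c / 4"
  proof -
    show "\<forall>\<^sub>F y in at_top. (1::real) \<le> y" by (rule eventually_ge_at_top)
    show "\<forall>\<^sub>F y in at_top. exp y \<ge> 2 * T"
      using exp_at_top[unfolded filterlim_at_top] by blast
    have lim: "((\<lambda>y. C / y) \<longlongrightarrow> 0) at_top" for C :: real by real_asymp
    show "\<forall>\<^sub>F y in at_top. CT / y < c / 4" by (rule order_tendstoD(2)[OF lim]) (use c0 in simp)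
    show "\<forall>\<^sub>F y in at_top. C1 / y < 1" by (rule order_tendstoD(2)[OF lim]) simp
    have "(Q \<longlongrightarrow> 0) at_top" unfolding Q_def B_def by real_asymp
    then show "\<forall>\<^sub>F y in at_top. Q y < c / 4" using c0 by (intro order_tendstoD(2)) auto
  qed
  then show ?thesis
  proof eventually_elim
    case (elim y)
    show ?case
    proof (rule ccontr)
      assume none: "\<not> ?case"
      have gap: "d \<le> \<bar>ln (real p) - y\<bar>" if "prime p" for p :: nat
      proof -
        have "\<not> \<bar>ln (real p) - y\<bar> < e" using none that by blast
        then show ?thesis using d(3) by linarith
      qed
      define x where "x = 1 + 1 / y"
      have x: "x > 1" "x \<in> {1<..2}" using elim(1) by (auto simp: x_def)
      define S where "S = (\<lambda>T z. \<Sum>n. mangoldt n * real n powr (-x) * fejer T (ln (real n) - z))"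
      define W where "W = (\<lambda>T z. \<Sum>n. real n powr (-x) * fejer T (ln (real n) - z))"
      have SW: "(\<Sum>n. (mangoldt n - 1) * real n powr (-x) * fejer T (ln (real n) - z)) = S T z - W T z"
        if "T > 0" for T z
        unfolding S_def W_def
        using suminf_diff[OF fejer_mangoldt_summable[OF x(1) that] fejer_one_summable[OF x(1) that], of z z]
        by (simp add: algebra_simps)
      have S1: "S 1 z \<le> 30 * pi + 1" if "z \<ge> y" for z
      proof -
        have z: "z > 0" using that elim(1) by linarith
        have "\<bar>S 1 z - W 1 z\<bar> \<le> C1 / z"
          using C1(2)[rule_format, OF x(2) z] by (simp only: SW[OF zero_less_one])
        moreover have "C1 / z \<le> C1 / y" using that elim(1) C1(1) by (intro divide_left_mono) auto
        moreover have "W 1 z \<le> 30 * pi" unfolding W_def by (rule fejer_one_sum_le[OF x(1)])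
        ultimately show ?thesis using elim(4) by linarith
      qed
      have ST: "S T y \<ge> c - CT / y"
      proof -
        have "\<bar>S T y - W T y\<bar> \<le> CT / y"
          using CT(2)[rule_format, OF x(2), of y] elim(1) by (simp only: SW[OF T0])
        moreover have "W T y \<ge> c" unfolding W_def c_def x_def by (rule fejer_sum_ge[OF T1 elim(1,2)])
        ultimately show ?thesis by linarith
      qed
      define E where "E = {n. n > 0 \<and> ln (real n) \<le> y + 1 \<and> primepow n \<and> \<not> prime n}"
      define E' where "E' = {n \<in> E. \<bar>ln (real n) - y\<bar> < d}"
      have E: "finite E" "real (card E) \<le> (exp ((y + 1) / 2) + 1) * (2 * (y + 1) + 1)"
        using card_proper_prime_powers_le[of "y + 1"] elim(1) unfolding E_def by auto
      have finE': "finite E'" using E(1) by (simp add: E'_def)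
      have B0: "B y \<ge> 0" using elim(1) T0 by (simp add: B_def)
      define R where "R = (\<lambda>n. A / T * (mangoldt n * real n powr (-x) * fejer 1 (ln (real n) - y) +
          mangoldt n * real n powr (-x) * fejer 1 (ln (real n) - (y + pi))))"
      have R0: "R n \<ge> 0" for n
        unfolding R_def using A0 T0 by (intro mult_nonneg_nonneg add_nonneg_nonneg) (auto simp: mangoldt_nonneg fejer_nonneg)
      have pw: "mangoldt n * real n powr (-x) * fejer T (ln (real n) - y) \<le> (if n \<in> E' then B y else 0) + R n" for n
      proof (cases "n \<in> E'")
        case True
        then have n: "n > 0" "ln (real n) \<le> y + 1" "ln (real n) \<ge> y - 1" using d(2) by (auto simp: E'_def E_def)
        have "mangoldt n \<le> y + 1" using mangoldt_le[OF n(1)] n(2) by linarith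
        moreover have "real n powr (-x) \<le> exp (1 - y)"
        proof -
          have "real n powr (-x) \<le> real n powr (-1)" using x n(1) by (intro powr_mono) auto
          also have "\<dots> = exp (- ln (real n))" using n(1) by (simp add: powr_def)
          also have "\<dots> \<le> exp (1 - y)" using n(3) by simp
          finally show ?thesis .
        qed
        ultimately have "(mangoldt n * real n powr (-x)) * fejer T (ln (real n) - y) \<le> ((y + 1) * exp (1 - y)) * T"
          using fejer_le[OF T0] elim(1) T0 by (intro mult_mono) (auto simp: mangoldt_nonneg fejer_nonneg)
        also have "\<dots> = B y" by (simp add: B_def)
        finally show ?thesis using R0[of n] True by simp
      next
        case False
        show ?thesis
        proof (cases "primepow n")
          case False
          then show ?thesis using R0[of n] \<open>n \<notin> E'\<close> by (simp add: mangoldt_def)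
        next
          case pp: True
          then have n0: "n > 0" using primepow_gt_Suc_0[of n] by linarith
          have far: "\<bar>ln (real n) - y\<bar> \<ge> d"
          proof (cases "prime n")
            case True
            then show ?thesis by (rule gap)
          next
            case np: False
            show ?thesis
            proof (rule ccontr)
              assume "\<not> ?thesis"
              then have lt: "\<bar>ln (real n) - y\<bar> < d" by simp
              then have "ln (real n) \<le> y + 1" using d(2) by linarith
              with lt np pp n0 False show False by (simp add: E'_def E_def)
            qed
          qed
          have eq: "ln (real n) - y - pi = ln (real n) - (y + pi)" by simp
          have "fejer T (ln (real n) - y) \<le> A / T * (fejer 1 (ln (real n) - y) + fejer 1 (ln (real n) - (y + pi)))"
            using fejer_tail_le[OF T0 d(1) far] unfolding A_def eq .
          then have "(mangoldt n * real n powr (-x)) * fejer T (ln (real n) - y) \<le>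
              (mangoldt n * real n powr (-x)) * (A / T * (fejer 1 (ln (real n) - y) + fejer 1 (ln (real n) - (y + pi))))"
            by (intro mult_left_mono) (auto simp: mangoldt_nonneg)
          also have "\<dots> = R n" by (simp add: R_def algebra_simps)
          finally show ?thesis using False by simp
        qed
      qed
      have "R sums (A / T * (S 1 y + S 1 (y + pi)))"
        unfolding R_def S_def
        by (intro sums_mult sums_add summable_sums fejer_mangoldt_summable x(1)) simp_all
      then have sR: "(\<lambda>n. (if n \<in> E' then B y else 0) + R n) sums ((\<Sum>n\<in>E'. B y) + A / T * (S 1 y + S 1 (y + pi)))"
        by (intro sums_add sums_If_finite_set finE')
      have sS: "(\<lambda>n. mangoldt n * real n powr (-x) * fejer T (ln (real n) - y)) sums S T y"
        unfolding S_def by (intro summable_sums fejer_mangoldt_summable x(1) T0)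
      have "S T y \<le> (\<Sum>n\<in>E'. B y) + A / T * (S 1 y + S 1 (y + pi))"
        by (rule sums_le[OF pw sS sR])
      moreover have "(\<Sum>n\<in>E'. B y) \<le> Q y"
      proof -
        have "card E' \<le> card E" by (rule card_mono[OF E(1)]) (auto simp: E'_def)
        then have "real (card E') \<le> (exp ((y + 1) / 2) + 1) * (2 * (y + 1) + 1)" using E(2) by linarith
        then have "real (card E') * B y \<le> Q y" unfolding Q_def using B0 by (rule mult_right_mono)
        then show ?thesis by simp
      qed
      moreover have "A / T * (S 1 y + S 1 (y + pi)) \<le> c / 4"
      proof -
        have "S 1 y + S 1 (y + pi) \<le> K" using S1[of y] S1[of "y + pi"] by (simp add: K_def)
        then have "A / T * (S 1 y + S 1 (y + pi)) \<le> A / T * K" using A0 T0 by (intro mult_left_mono) auto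
        then show ?thesis using AT by linarith
      qed
      ultimately show False using ST elim(3,5) c0 by linarith
    qed
  qed
qed

section \<open>Ruzsa sets and the Erdos-Turan inequality\<close>

text \<open>
  Ruzsa's construction: with a primitive root \<open>g\<close> modulo \<open>p\<close>, take for each \<open>i < p - 1\<close> the solution \<open>X i\<close> of
  \<open>x \<equiv> i\<close> modulo \<open>p - 1\<close> and \<open>x \<equiv> g ^ i\<close> modulo \<open>p\<close>. A sum \<open>X i + X j\<close> determines \<open>i + j\<close> modulo \<open>p - 1\<close>, hence
  the product of \<open>g ^ i\<close> and \<open>g ^ j\<close> modulo \<open>p\<close>, and also their sum; so it determines the pair.
\<close>

lemma ruzsa_sidon_set:
  fixes p :: nat
  assumes p: "prime p"
  obtains A where "A \<subseteq> {1..int (p * (p - 1))}" "card A = p - 1" "B2_set A"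
proof -
  have p1: "p > 1" using prime_gt_1_nat[OF p] .
  obtain g where g: "residue_primroot p g" using prime_primitive_root_exists[of p] p p1 by auto
  have cop: "coprime p g" and ord: "ord p g = p - 1"
    using g p by (auto simp: residue_primroot_def totient_prime)
  have "\<forall>i. \<exists>x. x < (p - 1) * p \<and> [x = i] (mod (p - 1)) \<and> [x = g ^ i] (mod p)"
  proof
    fix i
    have "coprime (p - 1) p" using p1 coprime_diff_one_left_nat[of p] by simp
    from binary_chinese_remainder_unique_nat[OF this, of i "g ^ i"] p1
    show "\<exists>x. x < (p - 1) * p \<and> [x = i] (mod (p - 1)) \<and> [x = g ^ i] (mod p)" by auto
  qed
  then obtain X where X: "\<And>i. X i < (p - 1) * p" "\<And>i. [X i = i] (mod (p - 1))" "\<And>i. [X i = g ^ i] (mod p)"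
    by metis
  have pow: "[g ^ i = g ^ j] (mod p) \<longleftrightarrow> [i = j] (mod (p - 1))" for i j
    using order_divides_expdiff[OF cop] ord by simp
  have eqI: "i = j" if "[i = j] (mod (p - 1))" "i < p - 1" "j < p - 1" for i j
    using that by (simp add: cong_def)
  have inj: "inj_on X {..<p - 1}"
  proof (rule inj_onI)
    fix i j assume ij: "i \<in> {..<p - 1}" "j \<in> {..<p - 1}" "X i = X j"
    have "[i = j] (mod (p - 1))" using X(2)[of i] X(2)[of j] ij(3) cong_sym cong_trans by metis
    then show "i = j" using ij by (intro eqI) auto
  qed
  have pos: "X i > 0" for i
  proof (rule ccontr)
    assume "\<not> X i > 0"
    then have "p dvd g ^ i" using X(3)[of i] by (simp add: cong_0_iff cong_sym_eq[of 0])
    then have "p dvd g" using p prime_dvd_power by blast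
    then have "p dvd 1" using coprime_common_divisor[OF cop] by simp
    then show False using p1 by simp
  qed
  have sidon: "(i = k \<and> j = l) \<or> (i = l \<and> j = k)"
    if m: "i < p - 1" "j < p - 1" "k < p - 1" "l < p - 1" and eq: "X i + X j = X k + X l" for i j k l
  proof -
    define a b c d where "a = int (g ^ i)" and "b = int (g ^ j)" and "c = int (g ^ k)" and "d = int (g ^ l)"
    have xa: "[int (X i) = a] (mod int p)" "[int (X j) = b] (mod int p)"
      "[int (X k) = c] (mod int p)" "[int (X l) = d] (mod int p)"
      unfolding a_def b_def c_def d_def cong_int_iff by (rule X(3))+
    have "[i + j = X i + X j] (mod (p - 1))" by (intro cong_add cong_sym[OF X(2)])
    moreover have "[X k + X l = k + l] (mod (p - 1))" by (intro cong_add X(2))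
    ultimately have "[i + j = k + l] (mod (p - 1))" using eq cong_trans by metis
    then have "[g ^ (i + j) = g ^ (k + l)] (mod p)" using pow by blast
    then have prod: "[a * b = c * d] (mod int p)"
      unfolding a_def b_def c_def d_def of_nat_mult[symmetric] cong_int_iff by (simp add: power_add)
    have "[a + b = int (X i) + int (X j)] (mod int p)" by (intro cong_add cong_sym[OF xa(1)] cong_sym[OF xa(2)])
    moreover have "int (X i) + int (X j) = int (X k) + int (X l)" using eq by linarith
    moreover have "[int (X k) + int (X l) = c + d] (mod int p)" by (intro cong_add xa)
    ultimately have sum: "[a + b = c + d] (mod int p)" using cong_trans by metis
    have "int p dvd (a + b) - (c + d)" "int p dvd a * b - c * d"
      using sum prod by (simp_all only: cong_iff_dvd_diff)
    then have "int p dvd a * ((a + b) - (c + d)) - (a * b - c * d)" by (rule dvd_diff[OF dvd_mult])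
    also have "a * ((a + b) - (c + d)) - (a * b - c * d) = (a - c) * (a - d)" by (simp add: algebra_simps)
    finally have "int p dvd (a - c) \<or> int p dvd (a - d)" using p prime_dvd_mult_iff[of "int p"] by simp
    then have "i = k \<or> i = l"
    proof
      assume "int p dvd (a - c)"
      then have "[g ^ i = g ^ k] (mod p)" unfolding a_def c_def by (simp only: cong_iff_dvd_diff[symmetric] cong_int_iff)
      then show ?thesis using pow eqI m by blast
    next
      assume "int p dvd (a - d)"
      then have "[g ^ i = g ^ l] (mod p)" unfolding a_def d_def by (simp only: cong_iff_dvd_diff[symmetric] cong_int_iff)
      then show ?thesis using pow eqI m by blast
    qed
    then show ?thesis using eq inj m by (auto simp: inj_on_def)
  qed
  show ?thesis
  proof (rule that[of "(\<lambda>i. int (X i)) ` {..<p - 1}"])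
    show "(\<lambda>i. int (X i)) ` {..<p - 1} \<subseteq> {1..int (p * (p - 1))}"
    proof
      fix x assume "x \<in> (\<lambda>i. int (X i)) ` {..<p - 1}"
      then obtain i where "x = int (X i)" by auto
      then show "x \<in> {1..int (p * (p - 1))}" using pos[of i] X(1)[of i]
        by (simp only: atLeastAtMost_iff of_nat_le_iff mult.commute[of p]) simp
    qed
    have "inj_on (\<lambda>i. int (X i)) {..<p - 1}" using inj by (auto simp: inj_on_def)
    then show "card ((\<lambda>i. int (X i)) ` {..<p - 1}) = p - 1" by (simp add: card_image)
    show "B2_set ((\<lambda>i. int (X i)) ` {..<p - 1})"
      unfolding B2_set_def
    proof (intro ballI iffI)
      fix a b c d :: int
      assume m: "a \<in> (\<lambda>i. int (X i)) ` {..<p - 1}" "b \<in> (\<lambda>i. int (X i)) ` {..<p - 1}"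
        "c \<in> (\<lambda>i. int (X i)) ` {..<p - 1}" "d \<in> (\<lambda>i. int (X i)) ` {..<p - 1}" and eq: "a + b = c + d"
      then obtain i j k l where ijkl: "i < p - 1" "j < p - 1" "k < p - 1" "l < p - 1"
        and abcd: "a = int (X i)" "b = int (X j)" "c = int (X k)" "d = int (X l)" by auto
      have "X i + X j = X k + X l" using eq unfolding abcd by linarith
      from sidon[OF ijkl this] show "{a, b} = {c, d}" unfolding abcd by auto
    qed (auto simp: doubleton_eq_iff)
  qed
qed

lemma F2_ge_card:
  assumes "A \<subseteq> {1..int n}" "B2_separated_set D A"
  shows "card A \<le> F2 D n"
  unfolding F2_def
proof (rule Max_ge)
  have "{card A | A. A \<subseteq> {1..int n} \<and> B2_separated_set D A} \<subseteq> card ` Pow {1..int n}" by auto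
  then show "finite {card A | A. A \<subseteq> {1..int n} \<and> B2_separated_set D A}" by (rule finite_subset) simp
qed (use assms in auto)

lemma B2_separated_dilation:
  fixes D :: nat
  assumes "D > 0" "B2_set A"
  shows "B2_separated_set (real D) ((\<lambda>a. int D * a) ` A)"
proof -
  have D: "real D > 0" using assms(1) by simp
  show ?thesis unfolding B2_separated_set_iff[OF D]
  proof (intro ballI impI)
    fix a b c d
    assume "a \<in> (\<lambda>a. int D * a) ` A" "b \<in> (\<lambda>a. int D * a) ` A" "c \<in> (\<lambda>a. int D * a) ` A" "d \<in> (\<lambda>a. int D * a) ` A"
      and ne: "{a, b} \<noteq> {c, d}"
    then obtain a' b' c' d' where m: "a' \<in> A" "b' \<in> A" "c' \<in> A" "d' \<in> A"
      and eq: "a = int D * a'" "b = int D * b'" "c = int D * c'" "d = int D * d'" by auto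
    have "{a', b'} \<noteq> {c', d'}" using ne unfolding eq by (auto simp: doubleton_eq_iff)
    then have "a' + b' \<noteq> c' + d'" using assms(2) m unfolding B2_set_def by blast
    then have "1 \<le> \<bar>(a' + b') - (c' + d')\<bar>" by linarith
    then have "int D * 1 \<le> int D * \<bar>(a' + b') - (c' + d')\<bar>" by (intro mult_left_mono) auto
    also have "\<dots> = \<bar>int D * ((a' + b') - (c' + d'))\<bar>" by (simp only: abs_mult abs_of_nat)
    also have "int D * ((a' + b') - (c' + d')) = (a + b) - (c + d)" unfolding eq by (simp add: algebra_simps)
    finally have "real_of_int (int D) \<le> real_of_int \<bar>(a + b) - (c + d)\<bar>" by (simp only: of_int_le_iff mult_1_right)
    then show "\<bar>real_of_int ((a + b) - (c + d))\<bar> \<ge> real D" by (simp only: of_int_abs of_int_of_nat_eq)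
  qed
qed

lemma F2_ge_prime:
  fixes D p :: nat
  assumes "D > 0" "prime p" "D * (p * (p - 1)) \<le> n"
  shows "p - 1 \<le> F2 (real D) n"
proof -
  obtain A where A: "A \<subseteq> {1..int (p * (p - 1))}" "card A = p - 1" "B2_set A" by (rule ruzsa_sidon_set[OF assms(2)])
  let ?A = "(\<lambda>a. int D * a) ` A"
  have "inj_on (\<lambda>a. int D * a) A" using assms(1) by (auto simp: inj_on_def)
  then have "card ?A = p - 1" using A(2) by (simp add: card_image)
  moreover have "?A \<subseteq> {1..int n}"
  proof
    fix x assume "x \<in> ?A"
    then obtain a where "a \<in> A" and x: "x = int D * a" by blast
    then have "a \<in> {1..int (p * (p - 1))}" using A(1) by blast
    then have a: "x = int D * a" "1 \<le> a" "a \<le> int (p * (p - 1))" using x by (simp_all only: atLeastAtMost_iff)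
    have "1 * 1 \<le> int D * a" using a assms(1) by (intro mult_mono) auto
    moreover have "int D * a \<le> int D * int (p * (p - 1))" using a(3) by (rule mult_left_mono) simp
    moreover have "int D * int (p * (p - 1)) \<le> int n" using assms(3) by (simp only: of_nat_mult[symmetric] of_nat_le_iff)
    ultimately show "x \<in> {1..int n}" unfolding x atLeastAtMost_iff by linarith
  qed
  ultimately show ?thesis using F2_ge_card[OF _ B2_separated_dilation[OF assms(1) A(3)], of n] by simp
qed

text \<open>
  The positive differences of \<open>A\<close> are distinct, at least \<open>D\<close>, and \<open>D\<close>-separated. So their integer quotients by \<open>D\<close>
  are distinct positive integers \<open>j\<close>, and the sum is at most the sum of \<open>u - D j\<close> over \<open>j \<le> u / D\<close>.
\<close>

lemma separated_differences_sum_le: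
  fixes A :: "int set" and D u :: nat
  assumes D: "D > 0" and A: "finite A" "B2_separated_set (real D) A"
  shows "(\<Sum>(a, b)\<in>{(a, b). a \<in> A \<and> b \<in> A \<and> b < a \<and> a - b < int u}. real u - real_of_int (a - b)) \<le> (real u)\<^sup>2 / (2 * real D)"
proof -
  let ?P = "{(a, b). a \<in> A \<and> b \<in> A \<and> b < a \<and> a - b < int u}"
  define f where "f = (\<lambda>(a, b). nat ((a - b) div int D) :: nat)"
  define m where "m = u div D"
  have sep: "\<bar>(a + b) - (c + d)\<bar> \<ge> int D" if "a \<in> A" "b \<in> A" "c \<in> A" "d \<in> A" "{a, b} \<noteq> {c, d}" for a b c d
  proof -
    have "\<bar>real_of_int ((a + b) - (c + d))\<bar> \<ge> real D" using A(2) D that by (subst (asm) B2_separated_set_iff) auto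
    then have "real_of_int \<bar>(a + b) - (c + d)\<bar> \<ge> real_of_int (int D)" by (simp only: of_int_abs of_int_of_nat_eq)
    then show ?thesis by (simp only: of_int_le_iff)
  qed
  have big: "int D \<le> a - b" if "(a, b) \<in> ?P" for a b
    using sep[of a a b a] that by (auto simp: doubleton_eq_iff)
  have lt: "int D * int (f (a, b)) \<le> a - b" "f (a, b) \<ge> 1" "f (a, b) \<le> m" if "(a, b) \<in> ?P" for a b
  proof -
    have nn: "(a - b) div int D \<ge> 0" using that D by (auto simp: pos_imp_zdiv_nonneg_iff)
    then have f: "int (f (a, b)) = (a - b) div int D" by (simp add: f_def)
    show "int D * int (f (a, b)) \<le> a - b" unfolding f
      using mult_div_mod_eq[of "int D" "a - b"] pos_mod_sign[of "int D" "a - b"] D by linarith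
    have "int D div int D \<le> (a - b) div int D" using big[OF that] D by (intro zdiv_mono1) auto
    then show "f (a, b) \<ge> 1" using D f by simp
    have "(a - b) div int D \<le> int u div int D" using that D by (intro zdiv_mono1) auto
    then have "int (f (a, b)) \<le> int (u div D)" unfolding f of_nat_div .
    then show "f (a, b) \<le> m" unfolding m_def by (simp only: of_nat_le_iff)
  qed
  have inj: "inj_on f ?P"
  proof (rule inj_onI)
    fix x y assume xy: "x \<in> ?P" "y \<in> ?P" "f x = f y"
    obtain a b c d where e: "x = (a, b)" "y = (c, d)" by (cases x, cases y) auto
    have P: "(a, b) \<in> ?P" "(c, d) \<in> ?P" using xy e by auto
    have "(a - b) div int D = (c - d) div int D"
      using xy(3) P D unfolding e f_def by (auto simp: eq_nat_nat_iff pos_imp_zdiv_nonneg_iff)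
    then have "(a - b) - (c - d) = (a - b) mod int D - (c - d) mod int D"
      unfolding minus_mult_div_eq_mod[symmetric] by (simp only: diff_diff_eq2)
    moreover have "0 \<le> (a - b) mod int D" "(a - b) mod int D < int D" "0 \<le> (c - d) mod int D" "(c - d) mod int D < int D"
      using D by auto
    ultimately have "\<bar>(a + d) - (c + b)\<bar> < int D" by linarith
    then have "{a, d} = {c, b}" using sep[of a d c b] P by fastforce
    then show "x = y" using P unfolding e by (auto simp: doubleton_eq_iff)
  qed
  have "(\<Sum>(a, b)\<in>?P. real u - real_of_int (a - b)) \<le> (\<Sum>x\<in>?P. real u - real D * real (f x))"
  proof (rule sum_mono)
    fix x assume x: "x \<in> ?P"
    obtain a b where e: "x = (a, b)" by (cases x)
    have "int (D * f (a, b)) \<le> a - b" using lt(1)[of a b] x e by simp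
    then have "real_of_int (int (D * f (a, b))) \<le> real_of_int (a - b)" by (simp only: of_int_le_iff)
    then show "(case x of (a, b) \<Rightarrow> real u - real_of_int (a - b)) \<le> real u - real D * real (f x)"
      unfolding e by simp
  qed
  also have "\<dots> = (\<Sum>j\<in>f ` ?P. real u - real D * real j)"
    using inj by (simp add: sum.reindex)
  also have "\<dots> \<le> (\<Sum>j\<in>{1..m}. real u - real D * real j)"
  proof (rule sum_mono2)
    show "f ` ?P \<subseteq> {1..m}" using lt by auto
    fix j assume "j \<in> {1..m} - f ` ?P"
    then have "D * j \<le> D * m" by simp
    also have "D * m \<le> u" by (simp add: m_def)
    finally have "real (D * j) \<le> real u" by (simp only: of_nat_le_iff)
    then show "0 \<le> real u - real D * real j" by simp
  qed simp
  also have "\<dots> = real m * real u - real D * (\<Sum>j\<in>{1..m}. real j)"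
    by (simp add: sum_subtractf sum_distrib_left)
  also have "(\<Sum>j\<in>{1..m}. real j) = real m * (real m + 1) / 2"
    by (induction m) (auto simp: field_simps)
  also have "real m * real u - real D * (real m * (real m + 1) / 2) \<le> (real u)\<^sup>2 / (2 * real D)"
  proof -
    have "(real m * real u - real D * (real m * (real m + 1) / 2)) * (2 * real D) =
        (real u)\<^sup>2 - (real u - real D * real m)\<^sup>2 - real D * (real D * real m)"
      by (simp add: power2_eq_square field_simps)
    also have "\<dots> \<le> (real u)\<^sup>2 - 0 - 0" by (intro diff_mono) simp_all
    also have "\<dots> = (real u)\<^sup>2" by simp
    finally have "(real m * real u - real D * (real m * (real m + 1) / 2)) * (2 * real D) \<le> (real u)\<^sup>2" .
    then show ?thesis using D by (simp add: pos_le_divide_eq)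
  qed
  finally show ?thesis .
qed

text \<open>
  The Erdos-Turan argument. The \<open>n + u\<close> windows \<open>[i, i + u)\<close> that may meet \<open>A\<close> contain \<open>u |A|\<close> points in total.
  The sum of the squares of these counts is bounded by the number of windows shared by pairs of points of \<open>A\<close>,
  and the Cauchy-Schwarz inequality compares the two.
\<close>

lemma erdos_turan_window:
  fixes A :: "int set" and D u n :: nat
  assumes D: "D > 0" and A: "A \<subseteq> {1..int n}" "B2_separated_set (real D) A"
  shows "(real u * real (card A))\<^sup>2 \<le> real (n + u) * (real u * real (card A) + (real u)\<^sup>2 / real D)"
proof -
  have fin: "finite A" using A(1) by (rule finite_subset) simp
  define I where "I = {1 - int u..int n}"
  have cI: "card I = n + u" unfolding I_def by simp
  define v where "v = (\<lambda>i a. if i \<le> a \<and> a < i + int u then 1 else (0::real))"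
  have s1: "(\<Sum>i\<in>I. \<Sum>a\<in>A. v i a) = real u * real (card A)"
  proof -
    have "(\<Sum>i\<in>I. v i a) = real u" if "a \<in> A" for a
    proof -
      have "(\<Sum>i\<in>I. v i a) = real (card {i \<in> I. i \<le> a \<and> a < i + int u})"
        unfolding v_def by (subst sum.inter_filter[symmetric]) (auto simp: I_def)
      also have "{i \<in> I. i \<le> a \<and> a < i + int u} = {a - int u + 1..a}" using A(1) that by (auto simp: I_def)
      finally show ?thesis by simp
    qed
    then show ?thesis by (subst sum.swap) simp
  qed
  have pair: "(\<Sum>i\<in>I. v i a * v i b) \<le> max 0 (real u - real_of_int \<bar>a - b\<bar>)" for a b
  proof -
    have "(\<Sum>i\<in>I. v i a * v i b) = real (card {i \<in> I. (i \<le> a \<and> a < i + int u) \<and> (i \<le> b \<and> b < i + int u)})"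
      unfolding v_def by (subst card_eq_sum, subst sum.inter_filter) (auto simp: I_def intro!: sum.cong)
    also have "\<dots> \<le> real (card {max a b - int u + 1..min a b})"
      by (intro of_nat_mono card_mono) auto
    also have "\<dots> = max 0 (real u - real_of_int \<bar>a - b\<bar>)" by (auto simp: max_def min_def)
    finally show ?thesis .
  qed
  define w where "w = (\<lambda>(a, b). max 0 (real u - real_of_int \<bar>a - b\<bar>))"
  let ?G = "{(a, b). a \<in> A \<and> b \<in> A \<and> b < a}" and ?L = "{(a, b). a \<in> A \<and> b \<in> A \<and> a < b}"
  let ?P = "{(a, b). a \<in> A \<and> b \<in> A \<and> b < a \<and> a - b < int u}"
  have fG: "finite ?G" "finite ?L" by (rule finite_subset[of _ "A \<times> A"]; use fin in auto)+
  have G: "(\<Sum>x\<in>?G. w x) \<le> (real u)\<^sup>2 / (2 * real D)"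
  proof -
    have "(\<Sum>x\<in>?G. w x) = (\<Sum>x\<in>?P. w x)"
      by (rule sum.mono_neutral_right[OF fG(1)]) (auto simp: w_def)
    also have "\<dots> = (\<Sum>(a, b)\<in>?P. real u - real_of_int (a - b))"
      by (rule sum.cong) (auto simp: w_def)
    also have "\<dots> \<le> (real u)\<^sup>2 / (2 * real D)" by (rule separated_differences_sum_le[OF D fin A(2)])
    finally show ?thesis .
  qed
  have L: "(\<Sum>x\<in>?L. w x) = (\<Sum>x\<in>?G. w x)"
    by (rule sum.reindex_bij_witness[of _ prod.swap prod.swap]) (auto simp: w_def abs_minus_commute)
  have diag: "(\<Sum>x\<in>(\<lambda>a. (a, a)) ` A. w x) = real u * real (card A)"
    by (subst sum.reindex) (auto simp: inj_on_def w_def)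
  have split: "A \<times> A = (\<lambda>a. (a, a)) ` A \<union> (?G \<union> ?L)" by auto
  have "(\<Sum>x\<in>A \<times> A. w x) = (\<Sum>x\<in>(\<lambda>a. (a, a)) ` A. w x) + ((\<Sum>x\<in>?G. w x) + (\<Sum>x\<in>?L. w x))"
    unfolding split using fG fin by (subst sum.union_disjoint, auto)+
  then have W: "(\<Sum>x\<in>A \<times> A. w x) \<le> real u * real (card A) + (real u)\<^sup>2 / real D"
    using G L diag by simp
  have s2: "(\<Sum>i\<in>I. (\<Sum>a\<in>A. v i a)\<^sup>2) \<le> real u * real (card A) + (real u)\<^sup>2 / real D"
  proof -
    have "(\<Sum>i\<in>I. (\<Sum>a\<in>A. v i a)\<^sup>2) = (\<Sum>i\<in>I. \<Sum>a\<in>A. \<Sum>b\<in>A. v i a * v i b)"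
      by (simp add: power2_eq_square sum_product)
    also have "\<dots> = (\<Sum>a\<in>A. \<Sum>i\<in>I. \<Sum>b\<in>A. v i a * v i b)" by (rule sum.swap)
    also have "\<dots> = (\<Sum>a\<in>A. \<Sum>b\<in>A. \<Sum>i\<in>I. v i a * v i b)" by (intro sum.cong refl sum.swap)
    also have "\<dots> \<le> (\<Sum>a\<in>A. \<Sum>b\<in>A. w (a, b))" unfolding w_def prod.case by (intro sum_mono pair)
    also have "\<dots> = (\<Sum>x\<in>A \<times> A. w x)" by (simp add: sum.cartesian_product)
    finally show ?thesis using W by linarith
  qed
  have "(real u * real (card A))\<^sup>2 = (\<Sum>i\<in>I. \<Sum>a\<in>A. v i a)\<^sup>2" by (simp add: s1)
  also have "\<dots> \<le> (\<Sum>i\<in>I. (\<Sum>a\<in>A. v i a)\<^sup>2) * real (card I)"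
    by (rule sum_squared_le_sum_of_squares)
  also have "\<dots> \<le> (real u * real (card A) + (real u)\<^sup>2 / real D) * real (card I)"
    by (intro mult_right_mono s2) simp
  finally show ?thesis by (simp add: cI mult.commute)
qed

section \<open>The asymptotic formula\<close>

lemma F2_le:
  fixes D u n :: nat
  assumes "D > 0" "u > 0"
  shows "(real (F2 (real D) n))\<^sup>2 \<le> real (n + u) * (real (F2 (real D) n) / real u + 1 / real D)"
proof -
  obtain A where A: "A \<subseteq> {1..int n}" "B2_separated_set (real D) A" "card A = F2 (real D) n"
    by (rule F2_attained)
  let ?F = "real (F2 (real D) n)"
  have "(real u)\<^sup>2 * ?F\<^sup>2 \<le> real (n + u) * (real u * ?F + (real u)\<^sup>2 / real D)"
    using erdos_turan_window[OF assms(1) A(1,2), of u] A(3) by (simp add: power_mult_distrib)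
  also have "\<dots> = (real u)\<^sup>2 * (real (n + u) * (?F / real u + 1 / real D))"
    using assms by (simp add: power2_eq_square field_simps)
  finally show ?thesis using assms(2) by (simp only: mult_le_cancel_left_pos zero_less_power of_nat_0_less_iff)
qed

text \<open>
  The window length is \<open>u = \<lceil>e n\<rceil>\<close>. The quadratic inequality for the ratio \<open>x\<close> is solved crudely: if \<open>x > 1\<close>,
  then \<open>x h + 1 \<le> x (1 + h)\<close>, and one factor \<open>x\<close> cancels.
\<close>

lemma F2_ratio_le:
  fixes D n :: nat and e :: real
  assumes D: "D > 0" and n: "n > 0" and e: "e > 0"
  shows "real (F2 (real D) n) / sqrt (real n / real D) \<le>
    max 1 ((1 + e + 1 / real n) * (1 + 1 / (e * sqrt (real n / real D))))"
proof -
  define N where "N = real n / real D"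
  define F where "F = real (F2 (real D) n)"
  define x where "x = F / sqrt N"
  define c where "c = 1 + e + 1 / real n"
  define h where "h = 1 / (e * sqrt N)"
  define u where "u = nat \<lceil>e * real n\<rceil>"
  have N: "N > 0" using D n by (simp add: N_def)
  have en: "e * real n > 0" using e n by simp
  have u: "u > 0" "e * real n \<le> real u" "real u \<le> e * real n + 1"
    using en by (simp_all add: u_def)
  have F0: "F \<ge> 0" by (simp add: F_def)
  have x0: "x \<ge> 0" using F0 N by (simp add: x_def)
  have c0: "c > 0" using e n by (simp add: c_def add_pos_nonneg)
  have h0: "h > 0" using e N by (simp add: h_def)
  have "F\<^sup>2 \<le> real (n + u) * (F / real u + 1 / real D)" unfolding F_def by (rule F2_le[OF D u(1)])
  also have "\<dots> \<le> (real n * c) * (F / (e * real n) + 1 / real D)"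
  proof (intro mult_mono add_right_mono)
    have "real n * c = real n + (e * real n + 1)" using n by (simp add: c_def distrib_left)
    then show "real (n + u) \<le> real n * c" using u(3) by simp
    show "F / real u \<le> F / (e * real n)" using u(2) en F0 by (intro divide_left_mono) auto
  qed (use n c0 F0 in auto)
  also have "\<dots> = N * (c * (F / (e * N) + 1))" using D n e by (simp add: N_def field_simps)
  also have "F / (e * N) = x * h"
  proof -
    have "e * N = sqrt N * (e * sqrt N)" using N by (simp add: mult_ac)
    then show ?thesis by (simp add: x_def h_def)
  qed
  finally have "F\<^sup>2 / N \<le> c * (x * h + 1)" using N by (simp add: divide_le_eq mult.commute)
  moreover have "x\<^sup>2 = F\<^sup>2 / N" using N by (simp add: x_def power_divide)
  ultimately have *: "x\<^sup>2 \<le> c * (x * h + 1)" by simp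
  have "x \<le> max 1 (c * (1 + h))"
  proof (cases "x \<le> 1")
    case False
    then have "c * (x * h + 1) \<le> c * (x * h + x)" using c0 by (intro mult_left_mono) auto
    also have "\<dots> = (c * (1 + h)) * x" by (simp add: algebra_simps)
    finally have "x * x \<le> (c * (1 + h)) * x" using * by (simp add: power2_eq_square)
    then have "x \<le> c * (1 + h)" using False by (simp only: mult_le_cancel_right)
    then show ?thesis by simp
  qed simp
  then show ?thesis unfolding x_def F_def N_def c_def h_def .
qed

text \<open>
  The point near which \<open>ln p\<close> lies is shifted by \<open>e\<close>, so that \<open>p\<close> is certainly below the square root of \<open>n / D\<close>
  and Ruzsa's set for \<open>p\<close> fits into the interval.
\<close>

lemma F2_ratio_ge:
  fixes D n p :: nat and e :: real
  assumes D: "D > 0" and n: "n > 0" and p: "prime p"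
    and near: "\<bar>ln (real p) - (ln (real n / real D) / 2 - e)\<bar> < e"
  shows "exp (- 2 * e) - 1 / sqrt (real n / real D) \<le> real (F2 (real D) n) / sqrt (real n / real D)"
proof -
  define N where "N = real n / real D"
  have N: "N > 0" using D n by (simp add: N_def)
  have p0: "real p > 0" using prime_gt_0_nat[OF p] by simp
  have sq: "exp (ln N / 2) = sqrt N"
    using N by (simp add: ln_sqrt[symmetric])
  have "ln (real p) < ln N / 2" using near unfolding N_def[symmetric] by linarith
  then have "exp (ln (real p)) < exp (ln N / 2)" by (simp only: exp_less_cancel_iff)
  then have "real p < sqrt N" using p0 sq by simp
  then have "(real p)\<^sup>2 < (sqrt N)\<^sup>2" using p0 by (intro power_strict_mono) auto
  then have "real D * (real p)\<^sup>2 < real n" using N D by (simp add: N_def field_simps)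
  then have "real (D * p\<^sup>2) < real n" by simp
  then have "D * p\<^sup>2 < n" by (simp only: of_nat_less_iff)
  moreover have "D * (p * (p - 1)) \<le> D * p\<^sup>2" by (simp add: power2_eq_square)
  ultimately have F: "p - 1 \<le> F2 (real D) n" by (intro F2_ge_prime[OF D p]) linarith
  have "- 2 * e + ln N / 2 < ln (real p)" using near unfolding N_def[symmetric] by linarith
  then have "exp (- 2 * e + ln N / 2) < exp (ln (real p))" by (simp only: exp_less_cancel_iff)
  then have "exp (- 2 * e) * sqrt N < real p" using p0 by (simp only: exp_add sq exp_ln)
  moreover have "real p - 1 \<le> real (F2 (real D) n)" using F by linarith
  ultimately have "exp (- 2 * e) * sqrt N - 1 \<le> real (F2 (real D) n)" by linarith
  then have "(exp (- 2 * e) * sqrt N - 1) / sqrt N \<le> real (F2 (real D) n) / sqrt N"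
    using N by (intro divide_right_mono) auto
  then show ?thesis unfolding N_def[symmetric] using N by (simp add: diff_divide_distrib)
qed

theorem theorem4:
  fixes \<Delta> :: nat
  assumes "\<Delta> > 0"
  shows "(\<lambda>n::nat. real (F2 (real \<Delta>) n) / sqrt (real n / real \<Delta>)) \<longlonglongrightarrow> 1"
proof (rule order_tendstoI)
  have D: "real \<Delta> > 0" using assms by simp
  have N: "filterlim (\<lambda>n. real n / real \<Delta>) at_top sequentially" using D by real_asymp
  fix a :: real assume a: "a < 1"
  define e where "e = (1 - a) / 4"
  have e: "e > 0" using a by (simp add: e_def)
  have "a < 1 + (- 2 * e)" using a by (simp add: e_def field_simps)
  also have "\<dots> \<le> exp (- 2 * e)" by (rule exp_ge_add_one_self)
  finally have ae: "a < exp (- 2 * e)" .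
  have "filterlim (\<lambda>n. ln (real n / real \<Delta>) / 2 - e) at_top sequentially" using D by real_asymp
  from filterlim_iff[THEN iffD1, OF this, rule_format, OF eventually_prime_ln_near[OF e]]
  have ev: "\<forall>\<^sub>F n in sequentially. \<exists>p. prime p \<and> \<bar>ln (real p) - (ln (real n / real \<Delta>) / 2 - e)\<bar> < e" .
  have "((\<lambda>n. exp (- 2 * e) - 1 / sqrt (real n / real \<Delta>)) \<longlonglongrightarrow> exp (- 2 * e))" using D by real_asymp
  from order_tendstoD(1)[OF this ae] ev eventually_gt_at_top[of 0]
  show "\<forall>\<^sub>F n in sequentially. a < real (F2 (real \<Delta>) n) / sqrt (real n / real \<Delta>)"
  proof eventually_elim
    case (elim n)
    then obtain p :: nat where "prime p" "\<bar>ln (real p) - (ln (real n / real \<Delta>) / 2 - e)\<bar> < e" by blast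
    from F2_ratio_ge[OF assms elim(3) this] elim(1) show ?case by linarith
  qed
next
  have D: "real \<Delta> > 0" using assms by simp
  fix a :: real assume a: "1 < a"
  define e where "e = (a - 1) / 2"
  have e: "e > 0" and ea: "1 + e < a" using a by (simp_all add: e_def field_simps)
  have "(\<lambda>n. (1 + e + 1 / real n) * (1 + 1 / (e * sqrt (real n / real \<Delta>)))) \<longlonglongrightarrow> 1 + e"
    using D e by real_asymp
  from order_tendstoD(2)[OF this ea] eventually_gt_at_top[of 0]
  show "\<forall>\<^sub>F n in sequentially. real (F2 (real \<Delta>) n) / sqrt (real n / real \<Delta>) < a"
  proof eventually_elim
    case (elim n)
    show ?case using F2_ratio_le[OF assms elim(2) e] elim(1) a by linarith
  qed
qed

end
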